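(* Let $G$ be a finite group, $\mathcal C\subset G$ a conjugacy class, $r\in\mathcal C$, $C_G$ the centraliser of $r$ in $G$ and $\pi$ an irreducible complex representation of $C_G$ on $V_\pi$. Let $H=\mathbb C(C_G)\otimes\mathbb CG$ be the quotient Hopf algebra of $D^\vee(G)$, let $V_{r,\pi}$ be the associated right $H$-comodule, and let $$E=(D^\vee(G)\otimes V_{r,\pi})^{H}$$ with its left $D^\vee(G)$-comodule structure induced by the coproduct of $D^\vee(G)$. Then $E$ is a coirreducible $D^\vee(G)$-comodule, and all coirreducible $D^\vee(G)$-comodules are obtained in this way (up to isomorphism, as $(\mathcal C,\pi)$ varies). As a corresponding left $D(G)$-module, $E\cong V_{\mathcal C,\pi}$.
   Context: $\mathbb C(G)$ denotes the functions on $G$ with basis of delta functions $\delta_g$, $\mathbb CG$ the group algebra, $e$ the identity of $G$, and $\delta_{a,b}$ the Kronecker delta. $D(G)$ is the Hopf algebra on $\mathbb C(G)\otimes\mathbb CG$ with product $(\delta_g\otimes h)(\delta_u\otimes v)=\delta_{g,huh^{-1}}\,\delta_g\otimes hv$ and tensor product coalgebra (with $\Delta\delta_g=\sum_{ab=g}\delta_a\otimes\delta_b$, $\Delta h=h\otimes h$). $D^\vee(G)$ is the Hopf algebra on $\mathbb C(G)\otimes\mathbb CG$ with tensor product algebra and counit and $\Delta(\delta_g\otimes h)=\sum_{f\in G}\delta_f\otimes f^{-1}ghg^{-1}f\otimes\delta_{f^{-1}g}\otimes h$, $S(\delta_g\otimes h)=\delta_{g^{-1}}\otimes gh^{-1}g^{-1}$.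 A left $D^\vee(G)$-comodule with coaction $x\mapsto x^{0}\otimes x^{1}$ corresponds to the left $D(G)$-module with action $\phi\triangleright x=\langle\phi,x^0\rangle x^1$, where $\langle\delta_g\otimes h,\delta_u\otimes v\rangle=\delta_{g,v^{-1}}\delta_{h,u^{-1}}$. $H=\mathbb C(C_G)\otimes\mathbb CG$ is the Hopf algebra quotient of $D^\vee(G)$ by the surjection $p:\delta_g\otimes h\mapsto\delta_g\otimes h$ if $g\in C_G$ and $0$ otherwise; $D^\vee(G)$ is a right $H$-comodule by $(\mathrm{id}\otimes p)\Delta$. $V_{r,\pi}=V_\pi$ as a vector space, with right $H$-coaction $\Delta_Rv=\sum_{g\in C_G}\pi(g)v\otimes\delta_g\otimes r$. $(D^\vee(G)\otimes V_{r,\pi})^H$ denotes the elements invariant under the tensor product right $H$-coaction. Fix $q:\mathcal C\to G$ with $q_crq_c^{-1}=c$ for all $c\in\mathcal C$ and $q_r=e$, and set $\zeta_c(g)=q_{gcg^{-1}}^{-1}gq_c\in C_G$. $V_{\mathcal C,\pi}=\mathbb C\mathcal C\otimes V_\pi$ is the irreducible $D(G)$-module with $h\triangleright(c\otimes w)=hch^{-1}\otimes\pi(\zeta_c(h))w$ and $\delta_g\triangleright(c\otimes w)=\delta_{g,c}\,c\otimes w$. *)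

theory Defs
  imports Complex_Main "HOL-Algebra.Group" "HOL-Library.Function_Algebras"
begin

section \<open>Complex vector spaces and tensor products with based spaces\<close>

text \<open>
  A complex vector space is a subspace \<open>M\<close> of a type carrying a scalar multiplication \<open>s\<close>.

  For a finite set \<open>B\<close>, the tensor product of the space with basis \<open>B\<close> and \<open>M\<close> is the space of
  functions \<open>X\<close> with values in \<open>M\<close> and support in \<open>B\<close>, where \<open>X\<close> stands for the sum over \<open>b \<in> B\<close> of
  \<open>b \<otimes> X b\<close>. The order of the two factors is not part of the encoding, so the same functions
  represent elements of either order of the tensor product. For \<open>M\<close> the complex numbers this is
  the space with basis \<open>B\<close> itself. Addition of functions is pointwise.
\<close>

definition complex_space :: "(complex \<Rightarrow> 'm::ab_group_add \<Rightarrow> 'm) \<Rightarrow> 'm set \<Rightarrow> bool"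
  where "complex_space s M \<longleftrightarrow> vector_space s \<and> module.subspace s M"

definition linear_map_on ::
    "(complex \<Rightarrow> 'm::ab_group_add \<Rightarrow> 'm) \<Rightarrow> 'm set \<Rightarrow>
     (complex \<Rightarrow> 'n::ab_group_add \<Rightarrow> 'n) \<Rightarrow> 'n set \<Rightarrow> ('m \<Rightarrow> 'n) \<Rightarrow> bool"
  where "linear_map_on s M t N f \<longleftrightarrow>
    (\<forall>x\<in>M. f x \<in> N) \<and> (\<forall>x\<in>M. \<forall>y\<in>M. f (x + y) = f x + f y) \<and>
    (\<forall>a. \<forall>x\<in>M. f (s a x) = t a (f x))"

definition fscale :: "(complex \<Rightarrow> 'm \<Rightarrow> 'm) \<Rightarrow> complex \<Rightarrow> ('b \<Rightarrow> 'm) \<Rightarrow> 'b \<Rightarrow> 'm"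
  where "fscale s a X = (\<lambda>b. s a (X b))"

definition tensor_space :: "'b set \<Rightarrow> 'm::zero set \<Rightarrow> ('b \<Rightarrow> 'm) set"
  where "tensor_space B M = {X. (\<forall>b\<in>B. X b \<in> M) \<and> (\<forall>b. b \<notin> B \<longrightarrow> X b = 0)}"

text \<open>The elementary tensor \<open>b \<otimes> v\<close>, and the basis vector \<open>b\<close>.\<close>

definition tens :: "'b \<Rightarrow> 'm::zero \<Rightarrow> 'b \<Rightarrow> 'm"
  where "tens b v = (\<lambda>b'. if b' = b then v else 0)"

abbreviation delta :: "'b \<Rightarrow> 'b \<Rightarrow> complex"
  where "delta b \<equiv> tens b 1"

section \<open>Hopf algebras with a finite basis, modules and comodules\<close>

text \<open>
  The structure maps are given by their values on basis vectors; \<open>hcomult\<close> takes values in the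
  space with basis \<open>hbasis \<times> hbasis\<close>.
\<close>

record 'b based_hopf =
  hbasis :: "'b set"
  hmult :: "'b \<Rightarrow> 'b \<Rightarrow> 'b \<Rightarrow> complex"
  hunit :: "'b \<Rightarrow> complex"
  hcomult :: "'b \<Rightarrow> 'b \<times> 'b \<Rightarrow> complex"
  hcounit :: "'b \<Rightarrow> complex"
  hantipode :: "'b \<Rightarrow> 'b \<Rightarrow> complex"

definition hspace :: "'b based_hopf \<Rightarrow> ('b \<Rightarrow> complex) set"
  where "hspace A = tensor_space (hbasis A) UNIV"

definition hprod :: "'b based_hopf \<Rightarrow> ('b \<Rightarrow> complex) \<Rightarrow> ('b \<Rightarrow> complex) \<Rightarrow> 'b \<Rightarrow> complex"
  where "hprod A x y = (\<Sum>a\<in>hbasis A. \<Sum>b\<in>hbasis A. fscale (*) (x a * y b) (hmult A a b))"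

definition hcoprod :: "'b based_hopf \<Rightarrow> ('b \<Rightarrow> complex) \<Rightarrow> 'b \<times> 'b \<Rightarrow> complex"
  where "hcoprod A x = (\<Sum>a\<in>hbasis A. fscale (*) (x a) (hcomult A a))"

definition hcounit_of :: "'b based_hopf \<Rightarrow> ('b \<Rightarrow> complex) \<Rightarrow> complex"
  where "hcounit_of A x = (\<Sum>a\<in>hbasis A. x a * hcounit A a)"

definition hantipode_of :: "'b based_hopf \<Rightarrow> ('b \<Rightarrow> complex) \<Rightarrow> 'b \<Rightarrow> complex"
  where "hantipode_of A x = (\<Sum>a\<in>hbasis A. fscale (*) (x a) (hantipode A a))"

text \<open>
  A coaction \<open>\<rho>\<close> of \<open>A\<close> on \<open>M\<close> sends \<open>x\<close> to the element \<open>\<rho> x\<close> of \<open>A \<otimes> M\<close> (left coactions) or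
  \<open>M \<otimes> A\<close> (right coactions), so that \<open>\<rho> x b\<close> is the coefficient in \<open>M\<close> of the basis vector \<open>b\<close>.
  The third condition below compares the coefficients of \<open>b \<otimes> b'\<close> in
  \<open>(\<Delta> \<otimes> id) (\<rho> x) = (id \<otimes> \<rho>) (\<rho> x)\<close>.
\<close>

definition left_comodule ::
    "'b based_hopf \<Rightarrow> (complex \<Rightarrow> 'm::ab_group_add \<Rightarrow> 'm) \<Rightarrow> 'm set \<Rightarrow> ('m \<Rightarrow> 'b \<Rightarrow> 'm) \<Rightarrow> bool"
  where "left_comodule A s M \<rho> \<longleftrightarrow>
    complex_space s M \<and>
    linear_map_on s M (fscale s) (tensor_space (hbasis A) M) \<rho> \<and>
    (\<forall>x\<in>M. \<forall>b\<in>hbasis A. \<forall>b'\<in>hbasis A.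
       (\<Sum>a\<in>hbasis A. s (hcomult A a (b, b')) (\<rho> x a)) = \<rho> (\<rho> x b) b') \<and>
    (\<forall>x\<in>M. (\<Sum>a\<in>hbasis A. s (hcounit A a) (\<rho> x a)) = x)"

definition subcomodule ::
    "'b based_hopf \<Rightarrow> (complex \<Rightarrow> 'm::ab_group_add \<Rightarrow> 'm) \<Rightarrow> 'm set \<Rightarrow> ('m \<Rightarrow> 'b \<Rightarrow> 'm) \<Rightarrow> 'm set \<Rightarrow> bool"
  where "subcomodule A s M \<rho> U \<longleftrightarrow>
    complex_space s U \<and> U \<subseteq> M \<and> (\<forall>x\<in>U. \<rho> x \<in> tensor_space (hbasis A) U)"

definition coirreducible ::
    "'b based_hopf \<Rightarrow> (complex \<Rightarrow> 'm::ab_group_add \<Rightarrow> 'm) \<Rightarrow> 'm set \<Rightarrow> ('m \<Rightarrow> 'b \<Rightarrow> 'm) \<Rightarrow> bool"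
  where "coirreducible A s M \<rho> \<longleftrightarrow>
    left_comodule A s M \<rho> \<and> M \<noteq> {0} \<and>
    (\<forall>U. subcomodule A s M \<rho> U \<longrightarrow> U = {0} \<or> U = M)"

definition comodule_isomorphic ::
    "'b based_hopf \<Rightarrow>
     (complex \<Rightarrow> 'm::ab_group_add \<Rightarrow> 'm) \<Rightarrow> 'm set \<Rightarrow> ('m \<Rightarrow> 'b \<Rightarrow> 'm) \<Rightarrow>
     (complex \<Rightarrow> 'n::ab_group_add \<Rightarrow> 'n) \<Rightarrow> 'n set \<Rightarrow> ('n \<Rightarrow> 'b \<Rightarrow> 'n) \<Rightarrow> bool"
  where "comodule_isomorphic A s M \<rho> t N \<sigma> \<longleftrightarrow>
    left_comodule A s M \<rho> \<and> left_comodule A t N \<sigma> \<and>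
    (\<exists>f. linear_map_on s M t N f \<and> bij_betw f M N \<and>
         (\<forall>x\<in>M. \<forall>b\<in>hbasis A. \<sigma> (f x) b = f (\<rho> x b)))"

definition left_module ::
    "'b based_hopf \<Rightarrow> (complex \<Rightarrow> 'm::ab_group_add \<Rightarrow> 'm) \<Rightarrow> 'm set \<Rightarrow>
     (('b \<Rightarrow> complex) \<Rightarrow> 'm \<Rightarrow> 'm) \<Rightarrow> bool"
  where "left_module A s M act \<longleftrightarrow>
    complex_space s M \<and>
    (\<forall>\<phi>\<in>hspace A. linear_map_on s M s M (act \<phi>)) \<and>
    (\<forall>x\<in>M. linear_map_on (fscale (*)) (hspace A) s M (\<lambda>\<phi>. act \<phi> x)) \<and>
    (\<forall>x\<in>M. act (hunit A) x = x) \<and>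
    (\<forall>\<phi>\<in>hspace A. \<forall>\<psi>\<in>hspace A. \<forall>x\<in>M. act (hprod A \<phi> \<psi>) x = act \<phi> (act \<psi> x))"

definition module_isomorphic ::
    "'b based_hopf \<Rightarrow>
     (complex \<Rightarrow> 'm::ab_group_add \<Rightarrow> 'm) \<Rightarrow> 'm set \<Rightarrow> (('b \<Rightarrow> complex) \<Rightarrow> 'm \<Rightarrow> 'm) \<Rightarrow>
     (complex \<Rightarrow> 'n::ab_group_add \<Rightarrow> 'n) \<Rightarrow> 'n set \<Rightarrow> (('b \<Rightarrow> complex) \<Rightarrow> 'n \<Rightarrow> 'n) \<Rightarrow> bool"
  where "module_isomorphic A s M act t N act' \<longleftrightarrow>
    left_module A s M act \<and> left_module A t N act' \<and>
    (\<exists>f. linear_map_on s M t N f \<and> bij_betw f M N \<and>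
         (\<forall>\<phi>\<in>hspace A. \<forall>x\<in>M. f (act \<phi> x) = act' \<phi> (f x)))"

text \<open>
  The tensor product of two right coactions, \<open>\<rho>\<close> on the space with basis \<open>B\<close> and \<open>\<sigma>\<close> on a space
  with scalar multiplication \<open>s\<close>:
  \<open>b \<otimes> v \<mapsto> b\<^sup>0 \<otimes> v\<^sup>0 \<otimes> b\<^sup>1 v\<^sup>1\<close>. Here \<open>\<rho> (delta b) h\<^sub>1\<close> and \<open>\<sigma> (X b) h\<^sub>2\<close> are the components
  along the basis vectors \<open>h\<^sub>1\<close> and \<open>h\<^sub>2\<close> of \<open>A\<close>.
\<close>

definition tensor_coaction ::
    "'h based_hopf \<Rightarrow> (complex \<Rightarrow> 'v::ab_group_add \<Rightarrow> 'v) \<Rightarrow> 'b set \<Rightarrow>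
     (('b \<Rightarrow> complex) \<Rightarrow> 'h \<Rightarrow> 'b \<Rightarrow> complex) \<Rightarrow> ('v \<Rightarrow> 'h \<Rightarrow> 'v) \<Rightarrow>
     ('b \<Rightarrow> 'v) \<Rightarrow> 'h \<Rightarrow> 'b \<Rightarrow> 'v"
  where "tensor_coaction A s B \<rho> \<sigma> X =
    (\<lambda>h. \<Sum>b\<in>B. \<Sum>h\<^sub>1\<in>hbasis A. \<Sum>h\<^sub>2\<in>hbasis A.
       fscale s (hmult A h\<^sub>1 h\<^sub>2 h) (\<lambda>b'. s (\<rho> (delta b) h\<^sub>1 b') (\<sigma> (X b) h\<^sub>2)))"

text \<open>The elements \<open>x\<close> of a right \<open>A\<close>-comodule on \<open>M\<close> that are sent to \<open>x \<otimes> 1\<close>.\<close>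

definition coinvariants ::
    "'h based_hopf \<Rightarrow> (complex \<Rightarrow> 'm::ab_group_add \<Rightarrow> 'm) \<Rightarrow> 'm set \<Rightarrow> ('m \<Rightarrow> 'h \<Rightarrow> 'm) \<Rightarrow> 'm set"
  where "coinvariants A s M \<rho> = {x\<in>M. \<forall>h\<in>hbasis A. \<rho> x h = s (hunit A h) x}"

section \<open>Groups and representations\<close>

definition conj_class :: "('g, 'z) monoid_scheme \<Rightarrow> 'g \<Rightarrow> 'g set"
  where "conj_class G x = (\<lambda>g. g \<otimes> x \<otimes> inv g) ` carrier G"
  for G (structure)

definition conj_classes :: "('g, 'z) monoid_scheme \<Rightarrow> 'g set set"
  where "conj_classes G = conj_class G ` carrier G"

definition centraliser :: "('g, 'z) monoid_scheme \<Rightarrow> 'g \<Rightarrow> 'g set"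
  where "centraliser G r = {g \<in> carrier G. g \<otimes> r = r \<otimes> g}"
  for G (structure)

definition representation_on ::
    "('g, 'z) monoid_scheme \<Rightarrow> 'g set \<Rightarrow>
     (complex \<Rightarrow> 'v::ab_group_add \<Rightarrow> 'v) \<Rightarrow> 'v set \<Rightarrow> ('g \<Rightarrow> 'v \<Rightarrow> 'v) \<Rightarrow> bool"
  where "representation_on G K s V \<pi> \<longleftrightarrow>
    complex_space s V \<and> (\<forall>k\<in>K. linear_map_on s V s V (\<pi> k)) \<and>
    (\<forall>v\<in>V. \<pi> \<one> v = v) \<and> (\<forall>k\<in>K. \<forall>l\<in>K. \<forall>v\<in>V. \<pi> (k \<otimes> l) v = \<pi> k (\<pi> l v))"
  for G (structure)

definition irreducible_rep ::
    "('g, 'z) monoid_scheme \<Rightarrow> 'g set \<Rightarrow>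
     (complex \<Rightarrow> 'v::ab_group_add \<Rightarrow> 'v) \<Rightarrow> 'v set \<Rightarrow> ('g \<Rightarrow> 'v \<Rightarrow> 'v) \<Rightarrow> bool"
  where "irreducible_rep G K s V \<pi> \<longleftrightarrow>
    representation_on G K s V \<pi> \<and> V \<noteq> {0} \<and>
    (\<forall>U. complex_space s U \<and> U \<subseteq> V \<and> (\<forall>k\<in>K. \<forall>u\<in>U. \<pi> k u \<in> U) \<longrightarrow> U = {0} \<or> U = V)"

section \<open>The quantum double, its dual and the quotient Hopf algebra\<close>

text \<open>The pair \<open>(g, h)\<close> stands for the basis vector \<open>\<delta>\<^sub>g \<otimes> h\<close>.\<close>

definition DG :: "('g, 'z) monoid_scheme \<Rightarrow> ('g \<times> 'g) based_hopf"
  where "DG G =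
    \<lparr> hbasis = carrier G \<times> carrier G,
      hmult = (\<lambda>(g, h) (u, v). if g = h \<otimes> u \<otimes> inv h then delta (g, h \<otimes> v) else 0),
      hunit = (\<Sum>g\<in>carrier G. delta (g, \<one>)),
      hcomult = (\<lambda>(g, h). \<Sum>(a, b)\<in>{(a, b) \<in> carrier G \<times> carrier G. a \<otimes> b = g}.
                            delta ((a, h), (b, h))),
      hcounit = (\<lambda>(g, h). if g = \<one> then 1 else 0),
      hantipode = (\<lambda>(g, h). delta (inv h \<otimes> inv g \<otimes> h, inv h)) \<rparr>"
  for G (structure)

text \<open>
  For a subgroup \<open>K\<close>, the following formulas define a Hopf algebra on \<open>\<complex>(K) \<otimes> \<complex>G\<close>. The case
  \<open>K = G\<close> is the dual of the double; the case that \<open>K\<close> is the centraliser of \<open>r\<close> is its quotient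
  \<open>H\<close>, see \<open>H_proj_hopf_quotient\<close> below.
\<close>

definition Dvee_on :: "('g, 'z) monoid_scheme \<Rightarrow> 'g set \<Rightarrow> ('g \<times> 'g) based_hopf"
  where "Dvee_on G K =
    \<lparr> hbasis = K \<times> carrier G,
      hmult = (\<lambda>(g, h) (u, v). if g = u then delta (g, h \<otimes> v) else 0),
      hunit = (\<Sum>g\<in>K. delta (g, \<one>)),
      hcomult = (\<lambda>(g, h). \<Sum>f\<in>K. delta ((f, inv f \<otimes> g \<otimes> h \<otimes> inv g \<otimes> f), (inv f \<otimes> g, h))),
      hcounit = (\<lambda>(g, h). if g = \<one> then 1 else 0),
      hantipode = (\<lambda>(g, h). delta (inv g, g \<otimes> inv h \<otimes> inv g)) \<rparr>"
  for G (structure)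

definition Dvee :: "('g, 'z) monoid_scheme \<Rightarrow> ('g \<times> 'g) based_hopf"
  where "Dvee G = Dvee_on G (carrier G)"

definition HH :: "('g, 'z) monoid_scheme \<Rightarrow> 'g \<Rightarrow> ('g \<times> 'g) based_hopf"
  where "HH G r = Dvee_on G (centraliser G r)"

definition H_proj :: "('g, 'z) monoid_scheme \<Rightarrow> 'g \<Rightarrow> ('g \<times> 'g \<Rightarrow> complex) \<Rightarrow> 'g \<times> 'g \<Rightarrow> complex"
  where "H_proj G r x = (\<lambda>(g, h). if g \<in> centraliser G r then x (g, h) else 0)"

definition hopf_quotient_map :: "'b based_hopf \<Rightarrow> 'c based_hopf \<Rightarrow> (('b \<Rightarrow> complex) \<Rightarrow> 'c \<Rightarrow> complex) \<Rightarrow> bool"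
  where "hopf_quotient_map A B p \<longleftrightarrow>
    linear_map_on (fscale (*)) (hspace A) (fscale (*)) (hspace B) p \<and> p ` hspace A = hspace B \<and>
    p (hunit A) = hunit B \<and>
    (\<forall>x\<in>hspace A. \<forall>y\<in>hspace A. p (hprod A x y) = hprod B (p x) (p y)) \<and>
    (\<forall>x\<in>hspace A. hcounit_of B (p x) = hcounit_of A x) \<and>
    (\<forall>x\<in>hspace A. hcoprod B (p x) =
       (\<Sum>(a, b)\<in>hbasis A \<times> hbasis A.
          fscale (*) (hcoprod A x (a, b)) (\<lambda>(c, d). p (delta a) c * p (delta b) d))) \<and>
    (\<forall>x\<in>hspace A. p (hantipode_of A x) = hantipode_of B (p x))"

text \<open>As a surjection, \<open>p\<close> determines the structure maps of \<open>B\<close> from those of \<open>A\<close>.\<close>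

lemma sum_fun_apply: "(\<Sum>a\<in>A. f a) x = (\<Sum>a\<in>A. f a x)"
  by (induction A rule: infinite_finite_induct) auto

lemma hcomult_Dvee_on:
  assumes "finite K"
  shows "hcomult (Dvee_on G K) a (b, b') =
    (if fst b \<in> K \<and> snd b = inv\<^bsub>G\<^esub> (fst b) \<otimes>\<^bsub>G\<^esub> fst a \<otimes>\<^bsub>G\<^esub> snd a \<otimes>\<^bsub>G\<^esub> inv\<^bsub>G\<^esub> (fst a) \<otimes>\<^bsub>G\<^esub> fst b \<and>
        b' = (inv\<^bsub>G\<^esub> (fst b) \<otimes>\<^bsub>G\<^esub> fst a, snd a) then 1 else 0)"
    (is "_ = (if fst b \<in> K \<and> ?P (fst b) then 1 else 0)")
proof -
  obtain g h u v w z where [simp]: "a = (g, h)" "b = (u, v)" "b' = (w, z)" by (metis surj_pair)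
  have "hcomult (Dvee_on G K) a (b, b') = (\<Sum>f\<in>K. if f = u then (if ?P f then 1 else 0) else 0)"
    by (auto simp: Dvee_on_def sum_fun_apply tens_def intro!: sum.cong)
  then show ?thesis using assms by (simp add: sum.delta)
qed

lemma H_proj_eq:
  assumes "x \<in> hspace (Dvee G)"
  shows "H_proj G r x = (\<lambda>b. if b \<in> hbasis (HH G r) then x b else 0)"
  using assms
  by (auto simp: H_proj_def hspace_def tensor_space_def Dvee_def HH_def Dvee_on_def fun_eq_iff centraliser_def)

lemma H_proj_hopf_quotient:
  assumes "group G" "finite (carrier G)" "r \<in> carrier G"
  shows "hopf_quotient_map (Dvee G) (HH G r) (H_proj G r)"
proof -
  interpret group G by fact
  define K where "K = centraliser G r"
  have K: "K \<subseteq> carrier G" by (auto simp: K_def centraliser_def)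
  have finK: "finite K" using K assms(2) finite_subset by blast
  have one: "\<one>\<^bsub>G\<^esub> \<in> K" using assms(3) by (auto simp: K_def centraliser_def)
  have mlt: "a \<otimes>\<^bsub>G\<^esub> b \<in> K" if "a \<in> K" "b \<in> K" for a b
    using that assms(3) unfolding K_def centraliser_def
    by (simp add: m_assoc) (metis m_assoc)
  have iv: "inv\<^bsub>G\<^esub> a \<in> K" if "a \<in> K" for a
    using that assms(3) unfolding K_def centraliser_def
    by simp (metis inv_closed inv_solve_left inv_solve_right m_assoc m_closed)
  let ?A = "Dvee G" and ?B = "HH G r" and ?p = "H_proj G r"
  have bA: "hbasis ?A = carrier G \<times> carrier G" by (simp add: Dvee_def Dvee_on_def)
  have bB: "hbasis ?B = K \<times> carrier G" by (simp add: HH_def Dvee_on_def K_def)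
  have bK: "hbasis (Dvee_on G K) = K \<times> carrier G" by (simp add: Dvee_on_def)
  have sub: "hbasis ?B \<subseteq> hbasis ?A" using K bA bB by auto
  have finA: "finite (hbasis ?A)" using assms(2) bA by auto
  have finB: "finite (hbasis ?B)" using finK assms(2) bB by auto
  have pe: "?p x b = (if b \<in> hbasis ?B then x b else 0)" if "x \<in> hspace ?A" for x b
    using H_proj_eq[OF that] by simp
  have deltaA: "delta a \<in> hspace ?A" if "a \<in> hbasis ?A" for a
    using that by (auto simp: hspace_def tensor_space_def tens_def)
  have pd: "?p (delta a) c = (if c = a \<and> c \<in> hbasis ?B then 1 else 0)" if "a \<in> hbasis ?A" for a c
    using pe[OF deltaA[OF that]] by (auto simp: tens_def)
  have mA: "hmult ?A a b c = (if fst a = fst b \<and> c = (fst a, snd a \<otimes>\<^bsub>G\<^esub> snd b) then 1 else 0)" for a b c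
    by (cases a; cases b) (auto simp: Dvee_def Dvee_on_def tens_def)
  have mB: "hmult ?B a b = hmult ?A a b" for a b
    by (auto simp: HH_def Dvee_def Dvee_on_def)
  have cA: "hcomult ?A a (b, b') = hcomult ?B a (b, b')" if "fst b \<in> K" for a b b'
    using that K assms(2) finK by (simp add: Dvee_def HH_def hcomult_Dvee_on K_def[symmetric] subset_iff)
  have cI: "fst a \<in> K" if "hcomult ?A a (b, b') \<noteq> 0" "fst b \<in> K" "fst b' \<in> K" "a \<in> hbasis ?A" for a b b'
  proof -
    have "fst b' = inv\<^bsub>G\<^esub> (fst b) \<otimes>\<^bsub>G\<^esub> fst a"
      using that assms(2) by (auto simp: Dvee_def hcomult_Dvee_on split: if_splits)
    then have "fst a = fst b \<otimes>\<^bsub>G\<^esub> fst b'"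
      using that(2,4) K bA by (metis inv_solve_left m_closed inv_closed mem_Times_iff subset_iff)
    then show ?thesis using mlt that by simp
  qed
  have cB: "b \<in> hbasis ?B \<and> b' \<in> hbasis ?B" if "hcomult ?B a (b, b') \<noteq> 0" "a \<in> hbasis ?B" for a b b'
    using that finK K by (cases b; cases a)
       (auto simp: HH_def hcomult_Dvee_on K_def[symmetric] bK mlt iv subset_iff split: if_splits)
  have hpA: "hprod ?A x y \<in> hspace ?A" for x y
    by (auto simp: hprod_def hspace_def tensor_space_def sum_fun_apply fscale_def mA bA intro!: sum.neutral)
  have anA: "hantipode ?A a c = (if c = (inv\<^bsub>G\<^esub> (fst a), fst a \<otimes>\<^bsub>G\<^esub> inv\<^bsub>G\<^esub> (snd a) \<otimes>\<^bsub>G\<^esub> inv\<^bsub>G\<^esub> (fst a)) then 1 else 0)" for a c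
    by (cases a) (auto simp: Dvee_def Dvee_on_def tens_def)
  have anB: "hantipode ?B a = hantipode ?A a" for a
    by (auto simp: HH_def Dvee_def Dvee_on_def)
  have haA: "hantipode_of ?A x \<in> hspace ?A" for x
    by (auto simp: hantipode_of_def hspace_def tensor_space_def sum_fun_apply fscale_def anA bA intro!: sum.neutral)
  have lin: "linear_map_on (fscale (*)) (hspace ?A) (fscale (*)) (hspace ?B) ?p"
    using sub by (auto simp: linear_map_on_def hspace_def tensor_space_def H_proj_def fscale_def fun_eq_iff bA bB K_def)
  have "hspace ?B \<subseteq> ?p ` hspace ?A"
  proof
    fix x assume x: "x \<in> hspace ?B"
    then have "x \<in> hspace ?A" using sub by (auto simp: hspace_def tensor_space_def)
    moreover have "?p x = x" using H_proj_eq[OF calculation] x by (auto simp: hspace_def tensor_space_def)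
    ultimately show "x \<in> ?p ` hspace ?A" by (metis image_eqI)
  qed
  then have onto: "?p ` hspace ?A = hspace ?B"
    using lin by (auto simp: linear_map_on_def)
  have uA: "hunit (Dvee_on G L) (g, h) = (if g \<in> L \<and> h = \<one>\<^bsub>G\<^esub> then 1 else 0)" if "finite L" for L g h
  proof -
    have "hunit (Dvee_on G L) (g, h) = (\<Sum>k\<in>L. if k = g then (if h = \<one>\<^bsub>G\<^esub> then 1 else 0) else 0)"
      by (auto simp: Dvee_on_def sum_fun_apply tens_def intro!: sum.cong)
    then show ?thesis using that by (simp add: sum.delta)
  qed
  have unit: "?p (hunit ?A) = hunit ?B"
    using assms(2) finK K by (auto simp: H_proj_def fun_eq_iff Dvee_def HH_def uA K_def[symmetric] subset_iff)
  have mult: "?p (hprod ?A x y) = hprod ?B (?p x) (?p y)" if "x \<in> hspace ?A" "y \<in> hspace ?A" for x y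
  proof
    fix c
    show "?p (hprod ?A x y) c = hprod ?B (?p x) (?p y) c"
    proof (cases "c \<in> hbasis ?B")
      case True
      have "(\<Sum>b\<in>hbasis ?A. x a * y b * hmult ?A a b c) = (\<Sum>b\<in>hbasis ?B. x a * y b * hmult ?A a b c)" for a
        using True by (intro sum.mono_neutral_right finA sub) (auto simp: mA bA bB)
      moreover have "(\<Sum>a\<in>hbasis ?A. \<Sum>b\<in>hbasis ?B. x a * y b * hmult ?A a b c)
          = (\<Sum>a\<in>hbasis ?B. \<Sum>b\<in>hbasis ?B. x a * y b * hmult ?A a b c)"
        using True by (intro sum.mono_neutral_right finA sub) (auto simp: mA bA bB intro!: sum.neutral split: if_splits)
      ultimately show ?thesis
        unfolding pe[OF hpA] using True that by (simp add: pe hprod_def sum_fun_apply fscale_def mB)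
    next
      case False
      then show ?thesis unfolding pe[OF hpA]
        by (auto simp: pe hprod_def sum_fun_apply fscale_def mB mA bB intro!: sum.neutral)
    qed
  qed
  have counit: "hcounit_of ?B (?p x) = hcounit_of ?A x" if "x \<in> hspace ?A" for x
  proof -
    have "hcounit_of ?A x = (\<Sum>a\<in>hbasis ?B. x a * hcounit ?A a)"
      unfolding hcounit_of_def using one
      by (intro sum.mono_neutral_right finA sub) (auto simp: bA bB Dvee_def Dvee_on_def split: if_splits)
    then show ?thesis
      using that by (simp add: hcounit_of_def pe Dvee_def HH_def Dvee_on_def cong: sum.cong)
  qed
  have anti: "?p (hantipode_of ?A x) = hantipode_of ?B (?p x)" if "x \<in> hspace ?A" for x
  proof
    fix c
    show "?p (hantipode_of ?A x) c = hantipode_of ?B (?p x) c"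
    proof (cases "c \<in> hbasis ?B")
      case True
      have "(\<Sum>a\<in>hbasis ?A. x a * hantipode ?A a c) = (\<Sum>a\<in>hbasis ?B. x a * hantipode ?A a c)"
        using True iv by (intro sum.mono_neutral_right finA sub) (fastforce simp: anA bA bB split: if_splits)+
      then show ?thesis
        unfolding pe[OF haA] using True that by (simp add: pe hantipode_of_def sum_fun_apply fscale_def anB)
    next
      case False
      then show ?thesis unfolding pe[OF haA] using K
        by (auto simp: pe hantipode_of_def sum_fun_apply fscale_def anB anA bB iv subset_iff intro!: sum.neutral)
    qed
  qed
  have comult: "hcoprod ?B (?p x) = (\<Sum>(a, b)\<in>hbasis ?A \<times> hbasis ?A.
      fscale (*) (hcoprod ?A x (a, b)) (\<lambda>(c, d). ?p (delta a) c * ?p (delta b) d))"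
    if x: "x \<in> hspace ?A" for x
  proof
    fix cd :: "('a \<times> 'a) \<times> ('a \<times> 'a)"
    obtain c d where [simp]: "cd = (c, d)" by (cases cd)
    have "(\<Sum>(a, b)\<in>hbasis ?A \<times> hbasis ?A.
        fscale (*) (hcoprod ?A x (a, b)) (\<lambda>(c, d). ?p (delta a) c * ?p (delta b) d)) cd
      = (\<Sum>t\<in>hbasis ?A \<times> hbasis ?A. if t = (c, d) then
           (if c \<in> hbasis ?B \<and> d \<in> hbasis ?B then hcoprod ?A x (c, d) else 0) else 0)"
      unfolding sum_fun_apply by (intro sum.cong) (auto simp: fscale_def pd split: if_splits)
    also have "\<dots> = (if c \<in> hbasis ?B \<and> d \<in> hbasis ?B then hcoprod ?A x (c, d) else 0)"
      using finA sub by (auto simp: sum.delta)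
    also have "\<dots> = hcoprod ?B (?p x) cd"
    proof (cases "c \<in> hbasis ?B \<and> d \<in> hbasis ?B")
      case True
      have "(\<Sum>a\<in>hbasis ?A. x a * hcomult ?A a (c, d)) = (\<Sum>a\<in>hbasis ?B. x a * hcomult ?A a (c, d))"
      proof (intro sum.mono_neutral_right finA sub ballI)
        fix a assume "a \<in> hbasis ?A - hbasis ?B"
        then show "x a * hcomult ?A a (c, d) = 0"
          using cI[of a c d] True by (auto simp: bA bB)
      qed
      then show ?thesis using True x cA[of c]
        by (auto simp: hcoprod_def sum_fun_apply fscale_def pe bB mem_Times_iff intro!: sum.cong)
    next
      case False
      then have "hcomult ?B a (c, d) = 0" if "a \<in> hbasis ?B" for a using cB that by blast
      with False show ?thesis by (auto simp add: hcoprod_def sum_fun_apply fscale_def)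
    qed
    finally show "hcoprod ?B (?p x) cd = (\<Sum>(a, b)\<in>hbasis ?A \<times> hbasis ?A.
      fscale (*) (hcoprod ?A x (a, b)) (\<lambda>(c, d). ?p (delta a) c * ?p (delta b) d)) cd" ..
  qed
  show ?thesis
    unfolding hopf_quotient_map_def using lin onto unit mult counit comult anti by blast
qed

section \<open>The comodule \<open>E\<close> and the module of a conjugacy class\<close>

text \<open>The right \<open>H\<close>-coaction \<open>(id \<otimes> p) \<Delta>\<close> on the dual of the double.\<close>

definition Dvee_coact ::
    "('g, 'z) monoid_scheme \<Rightarrow> 'g \<Rightarrow> ('g \<times> 'g \<Rightarrow> complex) \<Rightarrow> 'g \<times> 'g \<Rightarrow> 'g \<times> 'g \<Rightarrow> complex"
  where "Dvee_coact G r x = (\<lambda>h b. H_proj G r (\<lambda>b'. hcoprod (Dvee G) x (b, b')) h)"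

definition V_coact ::
    "('g, 'z) monoid_scheme \<Rightarrow> 'g \<Rightarrow> ('g \<Rightarrow> 'v::ab_group_add \<Rightarrow> 'v) \<Rightarrow> 'v \<Rightarrow> 'g \<times> 'g \<Rightarrow> 'v"
  where "V_coact G r \<pi> v = (\<Sum>g\<in>centraliser G r. tens (g, r) (\<pi> g v))"

definition E_space ::
    "('g, 'z) monoid_scheme \<Rightarrow> 'g \<Rightarrow> (complex \<Rightarrow> 'v::ab_group_add \<Rightarrow> 'v) \<Rightarrow> 'v set \<Rightarrow>
     ('g \<Rightarrow> 'v \<Rightarrow> 'v) \<Rightarrow> ('g \<times> 'g \<Rightarrow> 'v) set"
  where "E_space G r s V \<pi> =
    coinvariants (HH G r) (fscale s) (tensor_space (hbasis (Dvee G)) V)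
      (tensor_coaction (HH G r) s (hbasis (Dvee G)) (Dvee_coact G r) (V_coact G r \<pi>))"

text \<open>The left coaction \<open>\<Delta> \<otimes> id\<close>.\<close>

definition E_coact ::
    "('g, 'z) monoid_scheme \<Rightarrow> (complex \<Rightarrow> 'v::ab_group_add \<Rightarrow> 'v) \<Rightarrow>
     ('g \<times> 'g \<Rightarrow> 'v) \<Rightarrow> 'g \<times> 'g \<Rightarrow> 'g \<times> 'g \<Rightarrow> 'v"
  where "E_coact G s X =
    (\<lambda>b b'. \<Sum>a\<in>hbasis (Dvee G). s (hcomult (Dvee G) a (b, b')) (X a))"

definition pairing :: "('g, 'z) monoid_scheme \<Rightarrow> 'g \<times> 'g \<Rightarrow> 'g \<times> 'g \<Rightarrow> complex"
  where "pairing G = (\<lambda>(g, h) (u, v). if g = inv v \<and> h = inv u then 1 else 0)"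
  for G (structure)

definition DG_action_of_coact ::
    "('g, 'z) monoid_scheme \<Rightarrow> (complex \<Rightarrow> 'm::ab_group_add \<Rightarrow> 'm) \<Rightarrow> ('m \<Rightarrow> 'g \<times> 'g \<Rightarrow> 'm) \<Rightarrow>
     ('g \<times> 'g \<Rightarrow> complex) \<Rightarrow> 'm \<Rightarrow> 'm"
  where "DG_action_of_coact G s \<rho> \<phi> x =
    (\<Sum>b\<in>hbasis (Dvee G). s (\<Sum>a\<in>hbasis (DG G). \<phi> a * pairing G a b) (\<rho> x b))"

definition class_section :: "('g, 'z) monoid_scheme \<Rightarrow> 'g set \<Rightarrow> 'g \<Rightarrow> ('g \<Rightarrow> 'g) \<Rightarrow> bool"
  where "class_section G C r q \<longleftrightarrow>
    (\<forall>c\<in>C. q c \<in> carrier G \<and> q c \<otimes> r \<otimes> inv (q c) = c) \<and> q r = \<one>"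
  for G (structure)

definition zeta :: "('g, 'z) monoid_scheme \<Rightarrow> ('g \<Rightarrow> 'g) \<Rightarrow> 'g \<Rightarrow> 'g \<Rightarrow> 'g"
  where "zeta G q c g = inv (q (g \<otimes> c \<otimes> inv g)) \<otimes> g \<otimes> q c"
  for G (structure)

text \<open>
  The module of the class \<open>C\<close> lives on \<open>tensor_space C V\<close>; \<open>\<delta>\<^sub>g \<otimes> h\<close> acts as \<open>h\<close> followed by
  \<open>\<delta>\<^sub>g\<close>, because it is the product of \<open>\<delta>\<^sub>g \<otimes> \<one>\<close> and \<open>1 \<otimes> h\<close> in the double.
\<close>

definition class_group_act ::
    "('g, 'z) monoid_scheme \<Rightarrow> 'g set \<Rightarrow> ('g \<Rightarrow> 'g) \<Rightarrow> ('g \<Rightarrow> 'v::ab_group_add \<Rightarrow> 'v) \<Rightarrow>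
     'g \<Rightarrow> ('g \<Rightarrow> 'v) \<Rightarrow> 'g \<Rightarrow> 'v"
  where "class_group_act G C q \<pi> h X =
    (\<Sum>c\<in>C. tens (h \<otimes> c \<otimes> inv h) (\<pi> (zeta G q c h) (X c)))"
  for G (structure)

definition class_delta_act :: "'g set \<Rightarrow> 'g \<Rightarrow> ('g \<Rightarrow> 'v::ab_group_add) \<Rightarrow> 'g \<Rightarrow> 'v"
  where "class_delta_act C g X = (\<Sum>c\<in>C. if g = c then tens c (X c) else 0)"

definition class_act ::
    "('g, 'z) monoid_scheme \<Rightarrow> 'g set \<Rightarrow> ('g \<Rightarrow> 'g) \<Rightarrow> (complex \<Rightarrow> 'v::ab_group_add \<Rightarrow> 'v) \<Rightarrow>
     ('g \<Rightarrow> 'v \<Rightarrow> 'v) \<Rightarrow> ('g \<times> 'g \<Rightarrow> complex) \<Rightarrow> ('g \<Rightarrow> 'v) \<Rightarrow> 'g \<Rightarrow> 'v"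
  where "class_act G C q s \<pi> \<phi> X =
    (\<Sum>(g, h)\<in>hbasis (DG G).
       fscale s (\<phi> (g, h)) (class_delta_act C g (class_group_act G C q \<pi> h X)))"

end

theory Submission
  imports Defs
begin

text \<open>
  In terms of functions on \<open>G \<times> G\<close>, \<open>E\<close> consists of the functions \<open>X\<close> supported on \<open>G \<times> {inv r}\<close> with
  \<open>\<pi> k (X (u k, inv r)) = X (u, inv r)\<close> for \<open>k\<close> in the centraliser, that is, of the induced
  representation, and \<open>X \<mapsto> (c \<mapsto> X (q c, inv r))\<close> is the isomorphism with \<open>V\<^sub>C\<^sub>,\<^sub>\<pi>\<close>.
  A left comodule \<open>M\<close> is a right \<open>G\<close>-module with a compatible grading by \<open>G\<close>: the component of the
  coaction at \<open>(u, v)\<close> is translation by \<open>u\<close> followed by the projection to degree \<open>v\<close>. If \<open>M\<close> is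
  coirreducible, its homogeneous components of degree \<open>inv r\<close> vanish unless \<open>r\<close> is in one conjugacy
  class \<open>C\<close>; for \<open>r \<in> C\<close> such a component is an irreducible representation of the centraliser, and
  \<open>M\<close> is induced from it.
\<close>

section \<open>Linear maps on subspaces\<close>

text \<open>The scalar laws come from \<open>vector_space s\<close> on the whole type. Only the
  closure facts depend on \<open>M\<close>, so rewriting with the laws leaves no membership
  goals.\<close>

lemma complex_spaceD:
  assumes "complex_space s M"
  shows "vector_space s" "0 \<in> M" "x \<in> M \<Longrightarrow> y \<in> M \<Longrightarrow> x + y \<in> M" "x \<in> M \<Longrightarrow> s a x \<in> M"
    "(\<And>i. i \<in> I \<Longrightarrow> f i \<in> M) \<Longrightarrow> sum f I \<in> M"
    "s 1 x = x" "s 0 x = 0" "s a 0 = 0" "s a (x + y) = s a x + s a y" "s a (s b x) = s (a * b) x"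
    "s (a + b) x = s a x + s b x"
proof -
  show v: "vector_space s" using assms by (simp add: complex_space_def)
  interpret vector_space s by fact
  have M: "subspace M" using assms by (simp add: complex_space_def)
  show "0 \<in> M" "x \<in> M \<Longrightarrow> y \<in> M \<Longrightarrow> x + y \<in> M" "x \<in> M \<Longrightarrow> s a x \<in> M"
    "(\<And>i. i \<in> I \<Longrightarrow> f i \<in> M) \<Longrightarrow> sum f I \<in> M"
    using M by (auto simp: subspace_0 subspace_add subspace_scale subspace_sum)
  show "s 1 x = x" "s 0 x = 0" "s a 0 = 0" "s a (x + y) = s a x + s a y" "s a (s b x) = s (a * b) x"
    "s (a + b) x = s a x + s b x"
    by (auto simp: scale_right_distrib scale_left_distrib)
qed

lemma complex_space_iff:
  assumes "vector_space s"
  shows "complex_space s M \<longleftrightarrow> 0 \<in> M \<and> (\<forall>x\<in>M. \<forall>y\<in>M. x + y \<in> M) \<and> (\<forall>a. \<forall>x\<in>M. s a x \<in> M)"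
proof -
  interpret vector_space s by fact
  show ?thesis by (auto simp: complex_space_def assms subspace_def)
qed

lemma vector_space_fscale:
  assumes "vector_space s"
  shows "vector_space (fscale s)"
proof -
  interpret vector_space s by fact
  show ?thesis
    by unfold_locales (auto simp: fscale_def fun_eq_iff scale_right_distrib scale_left_distrib)
qed

lemma complex_space_tensor_space:
  assumes "complex_space s M"
  shows "complex_space (fscale s) (tensor_space B M)"
  using complex_spaceD[OF assms]
  by (auto simp: complex_space_iff vector_space_fscale tensor_space_def fscale_def)

lemma linear_map_onD:
  assumes "linear_map_on s M t N f"
  shows "x \<in> M \<Longrightarrow> f x \<in> N" "x \<in> M \<Longrightarrow> y \<in> M \<Longrightarrow> f (x + y) = f x + f y"
    "x \<in> M \<Longrightarrow> f (s a x) = t a (f x)"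
  using assms by (auto simp: linear_map_on_def)

lemma linear_map_on_zero:
  assumes "linear_map_on s M t N f" "complex_space s M"
  shows "f 0 = 0"
  using linear_map_onD(2)[OF assms(1), of 0 0] complex_spaceD(2)[OF assms(2)] by auto

lemma linear_map_on_sum:
  assumes "linear_map_on s M t N f" "complex_space s M" "\<And>i. i \<in> I \<Longrightarrow> g i \<in> M"
  shows "f (sum g I) = (\<Sum>i\<in>I. f (g i))"
  using assms(3)
proof (induction I rule: infinite_finite_induct)
  case (insert i I)
  then show ?case
    using linear_map_onD(2)[OF assms(1), of "g i" "sum g I"] complex_spaceD(5)[OF assms(2), of I g] by auto
qed (auto simp: linear_map_on_zero[OF assms(1,2)])

lemma complex_space_image:
  assumes "linear_map_on s M t N f" "complex_space s M" "complex_space t N"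
  shows "complex_space t (f ` M)"
proof -
  note M = complex_spaceD[OF assms(2)] and f = linear_map_onD[OF assms(1)]
  have "0 \<in> f ` M" using linear_map_on_zero[OF assms(1,2)] M(2) by (metis image_eqI)
  then show ?thesis
    by (auto simp: complex_space_iff[OF complex_spaceD(1)[OF assms(3)]] M f(2,3)[symmetric])
qed

text \<open>Structure is transported along the bijection: every vector of \<open>N\<close> is some
  \<open>f x\<close>, and \<open>comm\<close> turns each module axiom for \<open>act'\<close> into
  the image of the axiom for \<open>act\<close>. Thus \<open>act'\<close> need not be shown to be an
  action beforehand. The closure assumptions \<open>cl\<close> are there because \<open>comm\<close>
  covers only elements of \<open>hspace A\<close>.\<close>

lemma module_isomorphicI:
  assumes mod: "left_module A s M act" and N: "complex_space t N"
    and f: "linear_map_on s M t N f" and bij: "bij_betw f M N"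
    and comm: "\<And>\<phi> x. \<phi> \<in> hspace A \<Longrightarrow> x \<in> M \<Longrightarrow> f (act \<phi> x) = act' \<phi> (f x)"
    and cl: "hunit A \<in> hspace A" "\<And>\<phi> \<psi>. \<phi> \<in> hspace A \<Longrightarrow> \<psi> \<in> hspace A \<Longrightarrow> hprod A \<phi> \<psi> \<in> hspace A"
  shows "module_isomorphic A s M act t N act'"
proof -
  have M: "complex_space s M" using mod by (simp add: left_module_def)
  have im: "N = f ` M" using bij by (simp add: bij_betw_def)
  have sc: "complex_space (fscale (*)) (hspace A)"
  proof -
    have "vector_space ((*) :: complex \<Rightarrow> _)"
      by unfold_locales (auto simp: algebra_simps)
    then have "complex_space ((*) :: complex \<Rightarrow> _) UNIV" by (simp add: complex_space_iff)
    then show ?thesis unfolding hspace_def by (rule complex_space_tensor_space)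
  qed
  note fl = linear_map_onD[OF f] and Ms = complex_spaceD(2-4)[OF M] and Hs = complex_spaceD(2-4)[OF sc]
  have act: "act \<phi> x \<in> M" if "\<phi> \<in> hspace A" "x \<in> M" for \<phi> x
    using mod that by (auto simp: left_module_def linear_map_on_def)
  have "linear_map_on t N t N (act' \<phi>)" if "\<phi> \<in> hspace A" for \<phi>
  proof -
    have "linear_map_on s M s M (act \<phi>)" using mod that by (simp add: left_module_def)
    note al = linear_map_onD[OF this]
    show ?thesis unfolding linear_map_on_def im
      by (auto simp: comm[OF that, symmetric] fl(2,3)[symmetric] al Ms)
  qed
  moreover have "linear_map_on (fscale (*)) (hspace A) t N (\<lambda>\<phi>. act' \<phi> y)" if y: "y \<in> N" for y
  proof -
    obtain x where x: "x \<in> M" "y = f x" using y im by blast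
    have "linear_map_on (fscale (*)) (hspace A) s M (\<lambda>\<phi>. act \<phi> x)" using mod x by (simp add: left_module_def)
    note al = linear_map_onD[OF this]
    show ?thesis unfolding linear_map_on_def im x
      by (auto simp: comm[OF _ x(1), symmetric] fl(2,3)[symmetric] al Hs x)
  qed
  moreover have "act' (hunit A) y = y" if "y \<in> N" for y
    using mod that cl(1) by (auto simp: im comm[symmetric] left_module_def)
  moreover have "act' (hprod A \<phi> \<psi>) y = act' \<phi> (act' \<psi> y)"
    if "\<phi> \<in> hspace A" "\<psi> \<in> hspace A" "y \<in> N" for \<phi> \<psi> y
    using mod that cl(2) act by (auto simp: im comm[symmetric] left_module_def)
  ultimately have "left_module A t N act'" using N by (simp add: left_module_def)
  then show ?thesis using mod f bij comm by (auto simp: module_isomorphic_def)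
qed

section \<open>Comodules over the dual of the double\<close>

locale finite_group = group G for G (structure) +
  assumes finite_carrier [simp]: "finite (carrier G)"
begin

section \<open>Words and conjugation in the group\<close>

lemma inv_cancel_left:
  assumes "x \<in> carrier G" "y \<in> carrier G"
  shows "inv x \<otimes> (x \<otimes> y) = y" "x \<otimes> (inv x \<otimes> y) = y"
  using assms by (simp_all add: m_assoc[symmetric])

text \<open>Together with the simp rules for inverses, these bring a word to right-associated form
  with adjacent inverse pairs cancelled. Many conjugation identities below are checked this
  way.\<close>

lemmas group_normalize = m_assoc inv_mult_group inv_cancel_left

lemma conj_eq_iff:
  assumes "g \<in> carrier G" "x \<in> carrier G" "y \<in> carrier G"
  shows "g \<otimes> x \<otimes> inv g = y \<longleftrightarrow> x = inv g \<otimes> y \<otimes> g"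
proof
  assume "g \<otimes> x \<otimes> inv g = y"
  then show "x = inv g \<otimes> y \<otimes> g" using assms by (auto simp: group_normalize)
next
  assume "x = inv g \<otimes> y \<otimes> g"
  then show "g \<otimes> x \<otimes> inv g = y" using assms by (simp add: group_normalize)
qed

section \<open>Coproduct and counit of the dual, and its comodules\<close>

lemma hbasis_Dvee: "hbasis (Dvee G) = carrier G \<times> carrier G"
  and hbasis_DG: "hbasis (DG G) = carrier G \<times> carrier G"
  by (auto simp: Dvee_def Dvee_on_def DG_def)

text \<open>The coproduct formula read backwards: two tensor factors \<open>(u, v)\<close> and
  \<open>(w, z)\<close> can come only from the basis vector \<open>(u \<otimes> w, z)\<close>, and
  do so exactly when \<open>v\<close> is the conjugate of \<open>z\<close> by \<open>w\<close>. In
  this form a sum over the basis collapses to one term.\<close>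

lemma hcomult_Dvee_eq:
  assumes "g \<in> carrier G" "h \<in> carrier G"
  shows "hcomult (Dvee G) (g, h) ((u, v), (w, z)) =
    (if u \<in> carrier G \<and> w \<in> carrier G \<and> v = w \<otimes> z \<otimes> inv w \<and> g = u \<otimes> w \<and> h = z then 1 else 0)"
proof -
  have "w = inv u \<otimes> g \<longleftrightarrow> w \<in> carrier G \<and> g = u \<otimes> w" if "u \<in> carrier G"
    using that assms by (metis inv_solve_left m_closed inv_closed)
  moreover have "inv u \<otimes> (u \<otimes> w) \<otimes> h \<otimes> inv (u \<otimes> w) \<otimes> u = w \<otimes> h \<otimes> inv w"
    if "u \<in> carrier G" "w \<in> carrier G"
    using that assms by (simp add: group_normalize)
  ultimately show ?thesis
    using assms by (auto simp: Dvee_def hcomult_Dvee_on)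
qed

lemma sum_hcomult_Dvee:
  assumes "vector_space s"
  shows "(\<Sum>a\<in>hbasis (Dvee G). s (hcomult (Dvee G) a ((u, v), (w, z))) (F a)) =
    (if u \<in> carrier G \<and> w \<in> carrier G \<and> z \<in> carrier G \<and> v = w \<otimes> z \<otimes> inv w
     then F (u \<otimes> w, z) else 0)"
proof -
  interpret V: vector_space s by fact
  let ?P = "u \<in> carrier G \<and> w \<in> carrier G \<and> z \<in> carrier G \<and> v = w \<otimes> z \<otimes> inv w"
  have "(\<Sum>a\<in>hbasis (Dvee G). s (hcomult (Dvee G) a ((u, v), (w, z))) (F a))
    = (\<Sum>a\<in>carrier G \<times> carrier G. if a = (u \<otimes> w, z) then (if ?P then F a else 0) else 0)"
    unfolding hbasis_Dvee by (intro sum.cong refl) (auto simp: hcomult_Dvee_eq split: if_splits)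
  then show ?thesis by (auto simp: sum.delta)
qed

lemma sum_hcounit_Dvee:
  assumes "vector_space s"
  shows "(\<Sum>a\<in>hbasis (Dvee G). s (hcounit (Dvee G) a) (F a)) = (\<Sum>h\<in>carrier G. F (\<one>, h))"
proof -
  interpret V: vector_space s by fact
  have "(\<Sum>a\<in>hbasis (Dvee G). s (hcounit (Dvee G) a) (F a))
      = (\<Sum>g\<in>carrier G. \<Sum>h\<in>carrier G. s (hcounit (Dvee G) (g, h)) (F (g, h)))"
    by (simp add: hbasis_Dvee sum.cartesian_product)
  also have "\<dots> = (\<Sum>g\<in>carrier G. if g = \<one> then (\<Sum>h\<in>carrier G. F (\<one>, h)) else 0)"
    by (intro sum.cong) (auto simp: Dvee_def Dvee_on_def)
  finally show ?thesis by simp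
qed

text \<open>Only one term of each coassociativity sum survives. What remains says that translation
  by \<open>u\<close> and then by \<open>w\<close> is translation by \<open>u \<otimes> w\<close>,
  and that translation by \<open>w\<close> carries degree \<open>v\<close> to degree
  \<open>inv w \<otimes> v \<otimes> w\<close>. The counit axiom says that the projections to the
  degrees sum to the identity.\<close>

lemma left_comodule_Dvee_iff:
  "left_comodule (Dvee G) s M \<rho> \<longleftrightarrow>
    complex_space s M \<and>
    linear_map_on s M (fscale s) (tensor_space (carrier G \<times> carrier G) M) \<rho> \<and>
    (\<forall>x\<in>M. \<forall>u\<in>carrier G. \<forall>v\<in>carrier G. \<forall>w\<in>carrier G. \<forall>z\<in>carrier G.
       \<rho> (\<rho> x (u, v)) (w, z) = (if v = w \<otimes> z \<otimes> inv w then \<rho> x (u \<otimes> w, z) else 0)) \<and>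
    (\<forall>x\<in>M. (\<Sum>h\<in>carrier G. \<rho> x (\<one>, h)) = x)"
proof (cases "complex_space s M")
  case True
  note v = complex_spaceD(1)[OF True]
  show ?thesis
    by (auto simp: left_comodule_def hbasis_Dvee
        sum_hcomult_Dvee[OF v, unfolded hbasis_Dvee] sum_hcounit_Dvee[OF v, unfolded hbasis_Dvee])
      (metis m_closed inv_closed)+
qed (simp add: left_comodule_def)

section \<open>The coaction of \<open>E\<close> and the action of the double through the
  pairing\<close>

lemma E_coact_eq:
  assumes "vector_space s"
  shows "E_coact G s X (u, v) (w, z) =
    (if u \<in> carrier G \<and> w \<in> carrier G \<and> z \<in> carrier G \<and> v = w \<otimes> z \<otimes> inv w
     then X (u \<otimes> w, z) else 0)"
  by (simp add: E_coact_def sum_hcomult_Dvee[OF assms])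

text \<open>The pairing matches \<open>(g, h)\<close> with the single basis vector
  \<open>(inv h, inv g)\<close>. So the basis vector \<open>(g, h)\<close> of the double acts by
  translation by \<open>inv h\<close> followed by projection to degree \<open>inv g\<close>.\<close>

lemma DG_action_of_coact_eq:
  assumes "vector_space s"
  shows "DG_action_of_coact G s \<rho> \<phi> x =
    (\<Sum>(g, h)\<in>carrier G \<times> carrier G. s (\<phi> (g, h)) (\<rho> x (inv h, inv g)))"
proof -
  interpret V: vector_space s by fact
  have "(\<Sum>a\<in>hbasis (DG G). \<phi> a * pairing G a (u, v)) = \<phi> (inv v, inv u)"
    if "u \<in> carrier G" "v \<in> carrier G" for u v
  proof -
    have "(\<Sum>a\<in>hbasis (DG G). \<phi> a * pairing G a (u, v)) =
      (\<Sum>a\<in>carrier G \<times> carrier G. if a = (inv v, inv u) then \<phi> a else 0)"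
      unfolding hbasis_DG by (intro sum.cong) (auto simp: pairing_def split: if_splits)
    then show ?thesis using that by (simp add: sum.delta)
  qed
  then have "DG_action_of_coact G s \<rho> \<phi> x =
      (\<Sum>(u, v)\<in>carrier G \<times> carrier G. s (\<phi> (inv v, inv u)) (\<rho> x (u, v)))"
    unfolding DG_action_of_coact_def hbasis_Dvee by (intro sum.cong) auto
  also have "\<dots> = (\<Sum>(g, h)\<in>carrier G \<times> carrier G. s (\<phi> (g, h)) (\<rho> x (inv h, inv g)))"
    by (rule sum.reindex_bij_witness[where i = "\<lambda>(g, h). (inv h, inv g)" and j = "\<lambda>(g, h). (inv h, inv g)"])
      auto
  finally show ?thesis .
qed

lemma hmult_DG: "hmult (DG G) (g, h) (u, v) = (if g = h \<otimes> u \<otimes> inv h then delta (g, h \<otimes> v) else 0)"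
  by (simp add: DG_def)

lemma hunit_DG_eq: "hunit (DG G) (g, h) = (if g \<in> carrier G \<and> h = \<one> then 1 else 0)"
proof -
  have "hunit (DG G) (g, h) = (\<Sum>k\<in>carrier G. if k = g then (if h = \<one> then 1 else 0) else 0)"
    by (auto simp: DG_def sum_fun_apply tens_def intro!: sum.cong)
  then show ?thesis by (simp add: sum.delta)
qed

lemma hunit_DG: "hunit (DG G) \<in> hspace (DG G)"
  by (auto simp: hspace_def tensor_space_def hbasis_DG hunit_DG_eq)

lemma hprod_DG: "hprod (DG G) \<phi> \<psi> \<in> hspace (DG G)"
  by (auto simp: hspace_def tensor_space_def hbasis_DG hprod_def sum_fun_apply fscale_def hmult_DG tens_def
      intro!: sum.neutral)

text \<open>A twisted convolution: once the first factor \<open>(g, h)\<close> is fixed, the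
  relation of the double and the group component \<open>k\<close> determine the second factor, and
  only the sum over \<open>h\<close> is left.\<close>

lemma hprod_DG_eq:
  assumes "g \<in> carrier G" "k \<in> carrier G"
  shows "hprod (DG G) \<phi> \<psi> (g, k) =
    (\<Sum>h\<in>carrier G. \<phi> (g, h) * \<psi> (inv h \<otimes> g \<otimes> h, inv h \<otimes> k))"
proof -
  have *: "\<phi> (a, h) * \<psi> (u, v) * hmult (DG G) (a, h) (u, v) (g, k) =
    (if a = g then if (u, v) = (inv h \<otimes> g \<otimes> h, inv h \<otimes> k) then \<phi> (g, h) * \<psi> (u, v) else 0 else 0)"
    if "a \<in> carrier G" "h \<in> carrier G" "u \<in> carrier G" "v \<in> carrier G" for a h u v
  proof -
    have "k = h \<otimes> v \<longleftrightarrow> v = inv h \<otimes> k" using that assms by (metis inv_solve_left)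
    moreover have "g = h \<otimes> u \<otimes> inv h \<longleftrightarrow> u = inv h \<otimes> g \<otimes> h"
      using that assms by (metis inv_solve_left inv_solve_right m_assoc m_closed inv_closed)
    ultimately show ?thesis by (auto simp: hmult_DG tens_def)
  qed
  have "hprod (DG G) \<phi> \<psi> (g, k) =
    (\<Sum>(a, h)\<in>carrier G \<times> carrier G. \<Sum>(u, v)\<in>carrier G \<times> carrier G.
       \<phi> (a, h) * \<psi> (u, v) * hmult (DG G) (a, h) (u, v) (g, k))"
    by (simp add: hprod_def sum_fun_apply fscale_def hbasis_DG split_def)
  also have "\<dots> = (\<Sum>(a, h)\<in>carrier G \<times> carrier G. \<Sum>b\<in>carrier G \<times> carrier G.
       if b = (inv h \<otimes> g \<otimes> h, inv h \<otimes> k) then (if a = g then \<phi> (g, h) * \<psi> b else 0) else 0)"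
    by (intro sum.cong refl, clarify, intro sum.cong refl) (clarify, simp add: *)
  also have "\<dots> = (\<Sum>(a, h)\<in>carrier G \<times> carrier G.
       if a = g then \<phi> (g, h) * \<psi> (inv h \<otimes> g \<otimes> h, inv h \<otimes> k) else 0)"
    using assms by (intro sum.cong refl) (auto simp: sum.delta)
  also have "\<dots> = (\<Sum>h\<in>carrier G. \<Sum>a\<in>carrier G.
       if a = g then \<phi> (g, h) * \<psi> (inv h \<otimes> g \<otimes> h, inv h \<otimes> k) else 0)"
    unfolding sum.cartesian_product[symmetric] by (rule sum.swap)
  finally show ?thesis using assms by (simp add: sum.delta)
qed

text \<open>Translations compose as a right action. The inverses in the pairing reverse the order of
  composition, which yields a left action of the double.\<close>

lemma left_module_of_left_comodule:
  assumes "left_comodule (Dvee G) s M \<rho>"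
  shows "left_module (DG G) s M (DG_action_of_coact G s \<rho>)"
proof -
  have M: "complex_space s M"
    and lin: "linear_map_on s M (fscale s) (tensor_space (carrier G \<times> carrier G) M) \<rho>"
    and co: "\<And>x u v w z. x \<in> M \<Longrightarrow> u \<in> carrier G \<Longrightarrow> v \<in> carrier G \<Longrightarrow> w \<in> carrier G \<Longrightarrow> z \<in> carrier G \<Longrightarrow>
       \<rho> (\<rho> x (u, v)) (w, z) = (if v = w \<otimes> z \<otimes> inv w then \<rho> x (u \<otimes> w, z) else 0)"
    and cou: "\<And>x. x \<in> M \<Longrightarrow> (\<Sum>h\<in>carrier G. \<rho> x (\<one>, h)) = x"
    using assms by (auto simp: left_comodule_Dvee_iff)
  note Ms = complex_spaceD[OF M]
  interpret V: vector_space s by (rule Ms(1))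
  let ?act = "DG_action_of_coact G s \<rho>" and ?B = "carrier G \<times> carrier G"
  note act = DG_action_of_coact_eq[OF Ms(1), of \<rho>]
  have rM: "\<rho> x b \<in> M" if "x \<in> M" for x b
    using linear_map_onD(1)[OF lin that] Ms(2) by (cases b; cases "b \<in> ?B") (auto simp: tensor_space_def)
  have actM: "?act \<phi> x \<in> M" if "x \<in> M" for \<phi> x
    unfolding act using that by (auto intro!: Ms rM)
  have radd: "\<rho> (x + y) b = \<rho> x b + \<rho> y b" and rsc: "\<rho> (s a x) b = s a (\<rho> x b)"
    if "x \<in> M" "y \<in> M" for x y a b
    using linear_map_onD(2,3)[OF lin] that by (auto simp: fscale_def)
  have l1: "linear_map_on s M s M (?act \<phi>)" for \<phi>
    unfolding linear_map_on_def using actM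
    by (auto simp: act radd rsc Ms(9) V.scale_sum_right sum.distrib[symmetric] split_def mult.commute intro!: sum.cong)
  have l2: "linear_map_on (fscale (*)) (hspace (DG G)) s M (\<lambda>\<phi>. ?act \<phi> x)" if "x \<in> M" for x
    unfolding linear_map_on_def using actM[OF that]
    by (auto simp: act fscale_def Ms(11) V.scale_sum_right sum.distrib[symmetric] split_def intro!: sum.cong)
  have unit: "?act (hunit (DG G)) x = x" if "x \<in> M" for x
  proof -
    have "?act (hunit (DG G)) x = (\<Sum>g\<in>carrier G. \<Sum>h\<in>carrier G. if h = \<one> then \<rho> x (\<one>, inv g) else 0)"
      unfolding act sum.cartesian_product by (intro sum.cong) (auto simp: hunit_DG_eq)
    also have "\<dots> = (\<Sum>g\<in>carrier G. \<rho> x (\<one>, inv g))" by simp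
    also have "\<dots> = (\<Sum>g\<in>carrier G. \<rho> x (\<one>, g))"
      by (rule sum.reindex_bij_witness[where i = "\<lambda>g. inv g" and j = "\<lambda>g. inv g"]) auto
    finally show ?thesis using cou that by simp
  qed
  have prod: "?act (hprod (DG G) \<phi> \<psi>) x = ?act \<phi> (?act \<psi> x)" if x: "x \<in> M" for \<phi> \<psi> x
  proof -
    have inner: "\<rho> (?act \<psi> x) (inv h, inv g) =
        (\<Sum>k\<in>carrier G. s (\<psi> (inv h \<otimes> g \<otimes> h, inv h \<otimes> k)) (\<rho> x (inv k, inv g)))"
      if gh: "g \<in> carrier G" "h \<in> carrier G" for g h
    proof -
      have "\<rho> (?act \<psi> x) = (\<Sum>(u, v)\<in>?B. \<rho> (s (\<psi> (u, v)) (\<rho> x (inv v, inv u))))"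
        unfolding act using x
        by (subst linear_map_on_sum[OF lin M]) (auto simp: split_def intro!: Ms rM)
      then have "\<rho> (?act \<psi> x) (inv h, inv g) =
          (\<Sum>(u, v)\<in>?B. s (\<psi> (u, v)) (\<rho> (\<rho> x (inv v, inv u)) (inv h, inv g)))"
        by (simp add: sum_fun_apply split_def rsc[OF rM[OF x] rM[OF x]])
      \<comment> \<open>Compatibility of the grading with translation leaves only
        \<open>u = inv h \<otimes> g \<otimes> h\<close>, which is the relation defining the product
        of the double.\<close>
      also have "\<dots> = (\<Sum>(u, v)\<in>?B. if u = inv h \<otimes> g \<otimes> h then s (\<psi> (u, v)) (\<rho> x (inv (h \<otimes> v), inv g)) else 0)"
      proof (intro sum.cong refl, clarify)
        fix u v assume uv: "u \<in> carrier G" "v \<in> carrier G"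
        have "inv u = inv h \<otimes> inv g \<otimes> inv (inv h) \<longleftrightarrow> inv u = inv (inv h \<otimes> g \<otimes> h)"
          using uv gh by (simp add: inv_mult_group m_assoc)
        also have "\<dots> \<longleftrightarrow> u = inv h \<otimes> g \<otimes> h"
          using uv gh by (metis inv_inv inv_closed m_closed)
        finally show "s (\<psi> (u, v)) (\<rho> (\<rho> x (inv v, inv u)) (inv h, inv g)) =
           (if u = inv h \<otimes> g \<otimes> h then s (\<psi> (u, v)) (\<rho> x (inv (h \<otimes> v), inv g)) else 0)"
          using uv gh x by (simp add: co inv_mult_group)
      qed
      also have "\<dots> = (\<Sum>v\<in>carrier G. \<Sum>u\<in>carrier G. if u = inv h \<otimes> g \<otimes> h then s (\<psi> (u, v)) (\<rho> x (inv (h \<otimes> v), inv g)) else 0)"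
        unfolding sum.cartesian_product[symmetric] by (rule sum.swap)
      also have "\<dots> = (\<Sum>v\<in>carrier G. s (\<psi> (inv h \<otimes> g \<otimes> h, v)) (\<rho> x (inv (h \<otimes> v), inv g)))"
        using gh by (simp add: sum.delta)
      \<comment> \<open>The substitution \<open>k = h \<otimes> v\<close> gives the shape of the
        convolution in \<open>hprod_DG_eq\<close>.\<close>
      also have "\<dots> = (\<Sum>k\<in>carrier G. s (\<psi> (inv h \<otimes> g \<otimes> h, inv h \<otimes> k)) (\<rho> x (inv k, inv g)))"
        using gh by (intro sum.reindex_bij_witness[where i = "\<lambda>k. inv h \<otimes> k" and j = "\<lambda>k. h \<otimes> k"])
          (auto simp: m_assoc[symmetric])
      finally show ?thesis .
    qed
    have "?act \<phi> (?act \<psi> x) =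
       (\<Sum>g\<in>carrier G. \<Sum>h\<in>carrier G. \<Sum>k\<in>carrier G.
          s (\<phi> (g, h) * \<psi> (inv h \<otimes> g \<otimes> h, inv h \<otimes> k)) (\<rho> x (inv k, inv g)))"
      unfolding act[of \<phi>] sum.cartesian_product[symmetric]
      by (intro sum.cong refl) (simp add: inner V.scale_sum_right)
    also have "\<dots> = (\<Sum>g\<in>carrier G. \<Sum>k\<in>carrier G. \<Sum>h\<in>carrier G.
          s (\<phi> (g, h) * \<psi> (inv h \<otimes> g \<otimes> h, inv h \<otimes> k)) (\<rho> x (inv k, inv g)))"
      by (intro sum.cong refl sum.swap)
    also have "\<dots> = ?act (hprod (DG G) \<phi> \<psi>) x"
      unfolding act sum.cartesian_product[symmetric]
      by (intro sum.cong refl) (simp add: hprod_DG_eq V.scale_sum_left)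
    finally show ?thesis ..
  qed
  show ?thesis unfolding left_module_def using M l1 l2 unit prod by auto
qed

section \<open>The coinvariants\<close>

lemma centraliser_subset: "centraliser G r \<subseteq> carrier G"
  by (auto simp: centraliser_def)

lemma centraliser_closed:
  assumes "r \<in> carrier G"
  shows "\<one> \<in> centraliser G r"
    "k \<in> centraliser G r \<Longrightarrow> l \<in> centraliser G r \<Longrightarrow> k \<otimes> l \<in> centraliser G r"
    "k \<in> centraliser G r \<Longrightarrow> inv k \<in> centraliser G r"
proof -
  show "\<one> \<in> centraliser G r" using assms by (simp add: centraliser_def)
  show "k \<in> centraliser G r \<Longrightarrow> l \<in> centraliser G r \<Longrightarrow> k \<otimes> l \<in> centraliser G r"
    using assms unfolding centraliser_def by simp (metis m_assoc)
  show "k \<in> centraliser G r \<Longrightarrow> inv k \<in> centraliser G r"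
    using assms unfolding centraliser_def
    by simp (metis inv_closed inv_solve_left inv_solve_right m_assoc m_closed)
qed

text \<open>\<open>E\<close> is supported over \<open>inv r\<close>, so stabiliser conditions arise
  for \<open>inv r\<close> rather than \<open>r\<close>. Inverting a conjugate shows that both have
  the same centraliser.\<close>

lemma conj_eq_iff_centraliser:
  assumes "r \<in> carrier G" "g \<in> carrier G"
  shows "g \<otimes> r \<otimes> inv g = r \<longleftrightarrow> g \<in> centraliser G r"
    "g \<otimes> inv r \<otimes> inv g = inv r \<longleftrightarrow> g \<in> centraliser G r"
    "inv r = g \<otimes> inv r \<otimes> inv g \<longleftrightarrow> g \<in> centraliser G r"
proof -
  show 1: "g \<otimes> r \<otimes> inv g = r \<longleftrightarrow> g \<in> centraliser G r"
    using assms by (auto simp: centraliser_def inv_solve_right')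
  have "g \<otimes> inv r \<otimes> inv g = inv (g \<otimes> r \<otimes> inv g)"
    using assms by (simp add: group_normalize)
  then show 2: "g \<otimes> inv r \<otimes> inv g = inv r \<longleftrightarrow> g \<in> centraliser G r"
    using assms 1 by (metis inv_inv inv_closed m_closed)
  then show "inv r = g \<otimes> inv r \<otimes> inv g \<longleftrightarrow> g \<in> centraliser G r" by metis
qed

lemma V_coact_eq:
  "V_coact G r \<pi> v (k, t) = (if k \<in> centraliser G r \<and> t = r then \<pi> k v else 0)"
proof -
  have "finite (centraliser G r)"
    using finite_subset[OF centraliser_subset] by simp
  moreover have "V_coact G r \<pi> v (k, t) =
      (\<Sum>g\<in>centraliser G r. if g = k then (if t = r then \<pi> k v else 0) else 0)"
    unfolding V_coact_def sum_fun_apply by (intro sum.cong) (auto simp: tens_def)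
  ultimately show ?thesis by (simp add: sum.delta)
qed

lemma Dvee_coact_delta:
  assumes "g \<in> carrier G" "h \<in> carrier G"
  shows "Dvee_coact G r (delta (g, h)) (k, t) (u, w) =
    (if k \<in> centraliser G r \<and> u \<in> carrier G \<and> w = k \<otimes> t \<otimes> inv k \<and> g = u \<otimes> k \<and> h = t then 1 else 0)"
proof -
  have "hcoprod (Dvee G) (delta (g, h)) ((u, w), (k, t)) =
      (\<Sum>a\<in>carrier G \<times> carrier G. if a = (g, h) then hcomult (Dvee G) (g, h) ((u, w), (k, t)) else 0)"
    unfolding hcoprod_def sum_fun_apply hbasis_Dvee
    by (intro sum.cong) (auto simp: fscale_def tens_def)
  then show ?thesis
    using assms centraliser_subset[of r]
    by (auto simp: Dvee_coact_def H_proj_def sum.delta hcomult_Dvee_eq)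
qed

text \<open>Only one term of the triple sum survives. To produce \<open>(k, t)\<close>, the factor
  from \<open>V\<close> must be \<open>(k, r)\<close>, so the factor from the dual is
  \<open>(k, t \<otimes> inv r)\<close>. The coproduct then forces the basis vector
  \<open>(u \<otimes> k, t \<otimes> inv r)\<close>.\<close>

lemma tensor_coaction_E:
  assumes r: "r \<in> carrier G" and s: "vector_space s"
    and k: "k \<in> centraliser G r" and t: "t \<in> carrier G"
  shows "tensor_coaction (HH G r) s (hbasis (Dvee G)) (Dvee_coact G r) (V_coact G r \<pi>) X (k, t) (u, w) =
    (if u \<in> carrier G \<and> w = k \<otimes> (t \<otimes> inv r) \<otimes> inv k then \<pi> k (X (u \<otimes> k, t \<otimes> inv r)) else 0)"
proof -
  interpret V: vector_space s by (rule s)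
  let ?K = "centraliser G r"
  have kG: "k \<in> carrier G" using k centraliser_subset by blast
  have fK: "finite ?K" using finite_subset[OF centraliser_subset] by simp
  have hb: "hbasis (HH G r) = ?K \<times> carrier G" by (simp add: HH_def Dvee_on_def)
  \<comment> \<open>The conditions are nested in the order of the sums, innermost variable
    outermost, so that \<open>sum.delta\<close> removes one sum after another.\<close>
  have term_eq: "s (hmult (HH G r) h1 h2 (k, t)) (s (Dvee_coact G r (delta b) h1 (u, w)) (V_coact G r \<pi> (X b) h2))
    = (if h2 = (k, r) then if h1 = (k, t \<otimes> inv r) then if b = (u \<otimes> k, t \<otimes> inv r) then
        if u \<in> carrier G \<and> w = k \<otimes> (t \<otimes> inv r) \<otimes> inv k then \<pi> k (X b) else 0 else 0 else 0 else 0)"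
    if "b \<in> carrier G \<times> carrier G" "h1 \<in> ?K \<times> carrier G" "h2 \<in> ?K \<times> carrier G" for b h1 h2
  proof -
    obtain g h l y l' z where [simp]: "b = (g, h)" "h1 = (l, y)" "h2 = (l', z)" by (metis surj_pair)
    have "t = y \<otimes> r \<longleftrightarrow> y = t \<otimes> inv r"
      using that t r by (metis SigmaE2 \<open>h1 = (l, y)\<close> inv_solve_right)
    moreover have "hmult (HH G r) (l, y) (l', z) (k, t) = (if l = k \<and> l' = k \<and> t = y \<otimes> z then 1 else 0)"
      by (auto simp: HH_def Dvee_on_def tens_def)
    ultimately show ?thesis using that k
      by (auto simp: V_coact_eq Dvee_coact_delta)
  qed
  have "tensor_coaction (HH G r) s (hbasis (Dvee G)) (Dvee_coact G r) (V_coact G r \<pi>) X (k, t) (u, w) =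
    (\<Sum>b\<in>carrier G \<times> carrier G. \<Sum>h1\<in>?K \<times> carrier G. \<Sum>h2\<in>?K \<times> carrier G.
      if h2 = (k, r) then if h1 = (k, t \<otimes> inv r) then if b = (u \<otimes> k, t \<otimes> inv r) then
        if u \<in> carrier G \<and> w = k \<otimes> (t \<otimes> inv r) \<otimes> inv k then \<pi> k (X b) else 0 else 0 else 0 else 0)"
    unfolding tensor_coaction_def hbasis_Dvee hb sum_fun_apply fscale_def
    by (intro sum.cong refl term_eq)
  also have "\<dots> = (if u \<in> carrier G \<and> w = k \<otimes> (t \<otimes> inv r) \<otimes> inv k then \<pi> k (X (u \<otimes> k, t \<otimes> inv r)) else 0)"
    using fK k r t kG by (simp add: sum.delta)
  finally show ?thesis .
qed

text \<open>The unit of \<open>H\<close> is supported on the vectors \<open>(k, \<one>)\<close>.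
  Coinvariance at \<open>t = \<one>\<close> gives equivariance under the centraliser, and at
  \<open>t \<noteq> \<one>\<close> with \<open>k = \<one>\<close> it gives vanishing away from
  \<open>inv r\<close>. The converse uses that the centraliser fixes \<open>inv r\<close> under
  conjugation.\<close>

lemma E_space_iff:
  assumes r: "r \<in> carrier G" and rep: "representation_on G (centraliser G r) s V \<pi>"
  shows "X \<in> E_space G r s V \<pi> \<longleftrightarrow>
    (\<forall>b. X b \<in> V) \<and> (\<forall>u z. u \<in> carrier G \<and> z = inv r \<or> X (u, z) = 0) \<and>
    (\<forall>u\<in>carrier G. \<forall>k\<in>centraliser G r. \<pi> k (X (u \<otimes> k, inv r)) = X (u, inv r))"
    (is "_ \<longleftrightarrow> ?R")
proof -
  let ?K = "centraliser G r"
  have V: "complex_space s V" and lin: "k \<in> ?K \<Longrightarrow> linear_map_on s V s V (\<pi> k)"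
    and one: "v \<in> V \<Longrightarrow> \<pi> \<one> v = v" for k v
    using rep by (auto simp: representation_on_def)
  note Vs = complex_spaceD[OF V] and [simp] = linear_map_on_zero[OF lin V]
  interpret V: vector_space s by (rule Vs(1))
  have oneK: "\<one> \<in> ?K" and KG: "k \<in> ?K \<Longrightarrow> k \<in> carrier G" for k
    using centraliser_closed[OF r] by (auto simp: centraliser_def)
  have unit: "hunit (HH G r) (k, t) = (if t = \<one> then 1 else 0)" if "k \<in> ?K" for k t
  proof -
    have "hunit (HH G r) (k, t) = (\<Sum>l\<in>?K. if l = k then if t = \<one> then 1 else 0 else 0)"
      unfolding HH_def Dvee_on_def by (auto simp: sum_fun_apply tens_def intro!: sum.cong)
    then show ?thesis using that finite_subset[OF centraliser_subset] by (simp add: sum.delta)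
  qed
  have hb: "hbasis (HH G r) = ?K \<times> carrier G" by (simp add: HH_def Dvee_on_def)
  have conj: "k \<otimes> inv r \<otimes> inv k = inv r" if "k \<in> ?K" for k
    using conj_eq_iff_centraliser(2)[OF r KG[OF that]] that by blast
  have E: "X \<in> E_space G r s V \<pi> \<longleftrightarrow> X \<in> tensor_space (carrier G \<times> carrier G) V \<and>
    (\<forall>k\<in>?K. \<forall>t\<in>carrier G. \<forall>u w.
       (if u \<in> carrier G \<and> w = k \<otimes> (t \<otimes> inv r) \<otimes> inv k then \<pi> k (X (u \<otimes> k, t \<otimes> inv r)) else 0) =
       (if t = \<one> then X (u, w) else 0))"
  proof -
    let ?\<rho> = "tensor_coaction (HH G r) s (hbasis (Dvee G)) (Dvee_coact G r) (V_coact G r \<pi>)"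
    have "?\<rho> X (k, t) = fscale s (hunit (HH G r) (k, t)) X \<longleftrightarrow> (\<forall>u w.
       (if u \<in> carrier G \<and> w = k \<otimes> (t \<otimes> inv r) \<otimes> inv k then \<pi> k (X (u \<otimes> k, t \<otimes> inv r)) else 0) =
       (if t = \<one> then X (u, w) else 0))" if "k \<in> ?K" "t \<in> carrier G" for k t
      unfolding fun_eq_iff split_paired_All tensor_coaction_E[OF r Vs(1) that] unit[OF that(1)]
      by (cases "t = \<one>") (simp_all only: fscale_def if_True if_False Vs(6,7) simp_thms)
    moreover have "X \<in> E_space G r s V \<pi> \<longleftrightarrow> X \<in> tensor_space (carrier G \<times> carrier G) V \<and>
        (\<forall>k\<in>?K. \<forall>t\<in>carrier G. ?\<rho> X (k, t) = fscale s (hunit (HH G r) (k, t)) X)"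
      unfolding E_space_def coinvariants_def hb hbasis_Dvee by blast
    ultimately show ?thesis by blast
  qed
  show ?thesis
  proof
    assume X: "X \<in> E_space G r s V \<pi>"
    then have XV: "X b \<in> V" for b
      using Vs(2) unfolding E tensor_space_def by (cases b; cases "b \<in> carrier G \<times> carrier G") auto
    have co: "(if u \<in> carrier G \<and> w = k \<otimes> (t \<otimes> inv r) \<otimes> inv k then \<pi> k (X (u \<otimes> k, t \<otimes> inv r)) else 0) =
       (if t = \<one> then X (u, w) else 0)" if "k \<in> ?K" "t \<in> carrier G" for k t u w
      using X that unfolding E by blast
    have z: "X (u, z) = 0" if "\<not> (u \<in> carrier G \<and> z = inv r)" for u z
    proof (cases "u \<in> carrier G \<and> z \<in> carrier G")
      case True
      \<comment> \<open>The value \<open>t = z \<otimes> r\<close> is chosen so that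
        \<open>t \<otimes> inv r = z\<close>. It differs from the identity because
        \<open>z \<noteq> inv r\<close>.\<close>
      have "z \<otimes> r \<noteq> \<one>" using True that r by (metis inv_equality inv_inv inv_closed)
      then show ?thesis using co[OF oneK, of "z \<otimes> r" u z] True r that one[OF XV]
        by (simp add: m_assoc)
    next
      case False
      then show ?thesis using X unfolding E tensor_space_def by auto
    qed
    have "\<pi> k (X (u \<otimes> k, inv r)) = X (u, inv r)" if "u \<in> carrier G" "k \<in> ?K" for u k
      using co[OF that(2) one_closed, of u "inv r"] that r by (simp add: conj)
    with XV z show ?R by blast
  next
    assume R: ?R
    then have z: "X (u, z) = 0" if "\<not> (u \<in> carrier G \<and> z = inv r)" for u z
      using that by blast
    have "X \<in> tensor_space (carrier G \<times> carrier G) V"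
      using R r by (auto simp: tensor_space_def intro!: z)
    moreover have "(if u \<in> carrier G \<and> w = k \<otimes> (t \<otimes> inv r) \<otimes> inv k then \<pi> k (X (u \<otimes> k, t \<otimes> inv r)) else 0) =
       (if t = \<one> then X (u, w) else 0)" if "k \<in> ?K" "t \<in> carrier G" for k t u w
    proof (cases "t = \<one>")
      case True
      then show ?thesis using R that r by (auto simp: conj intro!: z[symmetric])
    next
      case False
      then have "t \<otimes> inv r \<noteq> inv r" using that r by (metis inv_closed r_cancel_one)
      then show ?thesis using False that by (simp add: z)
    qed
    ultimately show "X \<in> E_space G r s V \<pi>" unfolding E by blast
  qed
qed

section \<open>Coirreducibility of \<open>E\<close>\<close>

text \<open>The component at \<open>(u, v)\<close> translates \<open>X\<close> on the left by
  \<open>u\<close> and restricts it to the points \<open>(w, z)\<close> with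
  \<open>w \<otimes> z \<otimes> inv w = v\<close>. Both operations commute with right
  multiplication by the centraliser, since the conjugate of \<open>inv r\<close> by \<open>w\<close>
  depends only on the coset of \<open>w\<close>. The counit axiom holds because these restrictions
  partition the support.\<close>

lemma left_comodule_E:
  assumes r: "r \<in> carrier G" and rep: "representation_on G (centraliser G r) s V \<pi>"
  shows "left_comodule (Dvee G) (fscale s) (E_space G r s V \<pi>) (E_coact G s)"
proof -
  let ?K = "centraliser G r" and ?E = "E_space G r s V \<pi>"
  have V: "complex_space s V" and lin: "k \<in> ?K \<Longrightarrow> linear_map_on s V s V (\<pi> k)" for k
    using rep by (auto simp: representation_on_def)
  note Vs = complex_spaceD[OF V] and [simp] = linear_map_on_zero[OF lin V]
  note E = E_space_iff[OF r rep] and co = E_coact_eq[OF Vs(1)]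
  have KG: "k \<in> ?K \<Longrightarrow> k \<in> carrier G" for k by (simp add: centraliser_def)
  have cs: "complex_space (fscale s) ?E"
    unfolding complex_space_iff[OF vector_space_fscale[OF Vs(1)]]
  proof (intro conjI ballI allI)
    show "0 \<in> ?E" using Vs(2) by (simp add: E)
    show "X + Y \<in> ?E" if "X \<in> ?E" "Y \<in> ?E" for X Y
      using that linear_map_onD(2)[OF lin] unfolding E by (auto simp: Vs) (metis add.right_neutral)+
    show "fscale s a X \<in> ?E" if "X \<in> ?E" for a X
      using that linear_map_onD(3)[OF lin] unfolding E by (auto simp: Vs fscale_def) (metis Vs(8))+
  qed
  have mem: "E_coact G s X (u, v) \<in> ?E" if X: "X \<in> ?E" for X u v
    unfolding E
  proof (intro conjI allI ballI)
    show "E_coact G s X (u, v) b \<in> V" for b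
      using X by (cases b) (auto simp: E co Vs)
    show "w \<in> carrier G \<and> z = inv r \<or> E_coact G s X (u, v) (w, z) = 0" for w z
      using X by (auto simp: E co)
    show "\<pi> k (E_coact G s X (u, v) (w \<otimes> k, inv r)) = E_coact G s X (u, v) (w, inv r)"
      if w: "w \<in> carrier G" and k: "k \<in> ?K" for w k
    proof -
      have "w \<otimes> k \<otimes> inv r \<otimes> inv (w \<otimes> k) = w \<otimes> (k \<otimes> inv r \<otimes> inv k) \<otimes> inv w"
        using w r KG[OF k] by (simp add: group_normalize)
      also have "k \<otimes> inv r \<otimes> inv k = inv r"
        using conj_eq_iff_centraliser(2)[OF r KG[OF k]] k by blast
      finally show ?thesis
        using X w k r KG[OF k] unfolding E by (auto simp: co m_assoc[symmetric])
    qed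
  qed
  have lin_co: "linear_map_on (fscale s) ?E (fscale (fscale s)) (tensor_space (carrier G \<times> carrier G) ?E) (E_coact G s)"
    unfolding linear_map_on_def
  proof (intro conjI ballI allI)
    show "E_coact G s X \<in> tensor_space (carrier G \<times> carrier G) ?E" if X: "X \<in> ?E" for X
    proof -
      have "E_coact G s X (u, v) = 0" if "\<not> (u \<in> carrier G \<and> v \<in> carrier G)" for u v
        using that by (auto simp: fun_eq_iff co)
      then show ?thesis using mem[OF X] by (auto simp: tensor_space_def)
    qed
    show "E_coact G s (X + Y) = E_coact G s X + E_coact G s Y" for X Y
      by (auto simp: fun_eq_iff co)
    show "E_coact G s (fscale s a X) = fscale (fscale s) a (E_coact G s X)" for a X
      by (auto simp: fun_eq_iff co fscale_def Vs)
  qed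
  have comult: "E_coact G s (E_coact G s X (u, v)) (w, z) =
      (if v = w \<otimes> z \<otimes> inv w then E_coact G s X (u \<otimes> w, z) else 0)"
    if "u \<in> carrier G" "v \<in> carrier G" "w \<in> carrier G" "z \<in> carrier G" for X u v w z
  proof
    fix b :: "'a \<times> 'a"
    obtain x y where b: "b = (x, y)" by (cases b)
    have "w \<otimes> x \<otimes> y \<otimes> inv (w \<otimes> x) = w \<otimes> (x \<otimes> y \<otimes> inv x) \<otimes> inv w" if "x \<in> carrier G" "y \<in> carrier G"
      using that \<open>w \<in> carrier G\<close> by (simp add: group_normalize)
    then show "E_coact G s (E_coact G s X (u, v)) (w, z) b =
      (if v = w \<otimes> z \<otimes> inv w then E_coact G s X (u \<otimes> w, z) else 0) b"
      using that by (auto simp: b co m_assoc[symmetric])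
  qed
  have counit: "(\<Sum>h\<in>carrier G. E_coact G s X (\<one>, h)) = X" if X: "X \<in> ?E" for X
  proof
    fix b :: "'a \<times> 'a"
    obtain x y where b: "b = (x, y)" by (cases b)
    have "(\<Sum>h\<in>carrier G. E_coact G s X (\<one>, h)) b =
       (\<Sum>h\<in>carrier G. if h = x \<otimes> y \<otimes> inv x then if x \<in> carrier G \<and> y \<in> carrier G then X (x, y) else 0 else 0)"
      unfolding sum_fun_apply b by (intro sum.cong) (auto simp: co)
    also have "\<dots> = (if x \<in> carrier G \<and> y \<in> carrier G then X (x, y) else 0)"
      by (auto simp: sum.delta)
    also have "\<dots> = X b"
    proof -
      have "x \<in> carrier G \<and> y = inv r \<or> X (x, y) = 0" using X unfolding E by blast
      then show ?thesis using r by (auto simp: b)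
    qed
    finally show "(\<Sum>h\<in>carrier G. E_coact G s X (\<one>, h)) b = X b" .
  qed
  show ?thesis
    unfolding left_comodule_Dvee_iff using cs lin_co comult counit by blast
qed

text \<open>
  A nonzero subcomodule evaluates at \<open>(\<one>, inv r)\<close> onto \<open>V\<close>. An element \<open>Y\<close> of \<open>E\<close> is the average over
  \<open>g\<close> of its restrictions to the cosets of \<open>g\<close>, and such a restriction is a component of the coaction
  on any \<open>X\<close> with \<open>X (\<one>, inv r) = Y (g, inv r)\<close>.
\<close>

lemma coirreducible_E:
  fixes V :: "'v::ab_group_add set"
  assumes r: "r \<in> carrier G" and irr: "irreducible_rep G (centraliser G r) s V \<pi>"
  shows "coirreducible (Dvee G) (fscale s) (E_space G r s V \<pi>) (E_coact G s)"
proof -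
  let ?K = "centraliser G r" and ?E = "E_space G r s V \<pi>"
  have rep: "representation_on G ?K s V \<pi>" and V0: "V \<noteq> {0}"
    and irrU: "\<And>U. complex_space s U \<Longrightarrow> U \<subseteq> V \<Longrightarrow> (\<And>k u. k \<in> ?K \<Longrightarrow> u \<in> U \<Longrightarrow> \<pi> k u \<in> U) \<Longrightarrow> U = {0} \<or> U = V"
    using irr by (auto simp: irreducible_rep_def)
  have V: "complex_space s V" and lin: "k \<in> ?K \<Longrightarrow> linear_map_on s V s V (\<pi> k)"
    and one: "v \<in> V \<Longrightarrow> \<pi> \<one> v = v"
    and mult: "k \<in> ?K \<Longrightarrow> l \<in> ?K \<Longrightarrow> v \<in> V \<Longrightarrow> \<pi> (k \<otimes> l) v = \<pi> k (\<pi> l v)" for k l v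
    using rep by (auto simp: representation_on_def)
  note Vs = complex_spaceD[OF V] and [simp] = linear_map_on_zero[OF lin V]
  note E = E_space_iff[OF r rep] and co = E_coact_eq[OF Vs(1)]
  interpret V: vector_space s by (rule Vs(1))
  have KG: "k \<in> ?K \<Longrightarrow> k \<in> carrier G" for k by (simp add: centraliser_def)
  note Kc = centraliser_closed[OF r]
  have fK: "finite ?K" using finite_subset[OF centraliser_subset] by simp
  have \<pi>V: "\<pi> k v \<in> V" if "k \<in> ?K" "v \<in> V" for k v using linear_map_onD(1)[OF lin] that by blast
  have zero: "X (u, z) = 0" if "X \<in> ?E" "\<not> (u \<in> carrier G \<and> z = inv r)" for X u z
    using that unfolding E by blast
  have \<pi>E: "X (k, inv r) = \<pi> (inv k) (X (\<one>, inv r))" if "X \<in> ?E" "k \<in> ?K" for X k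
  proof -
    have "\<pi> (inv k) (X (k \<otimes> inv k, inv r)) = X (k, inv r)"
      using that KG Kc unfolding E by blast
    then show ?thesis using that KG by simp
  qed
  have ex: "\<exists>X\<in>?E. X (\<one>, inv r) = v" if v: "v \<in> V" for v
  proof
    \<comment> \<open>The value \<open>v\<close> at the identity is extended by equivariance over
      the centraliser and by zero over the other cosets.\<close>
    define X where "X = (\<lambda>(u, z). if u \<in> ?K \<and> z = inv r then \<pi> (inv u) v else 0)"
    show "X (\<one>, inv r) = v" using Kc v by (simp add: X_def one)
    have "\<pi> k (X (u \<otimes> k, inv r)) = X (u, inv r)" if u: "u \<in> carrier G" and k: "k \<in> ?K" for u k
    proof -
      have "u \<otimes> k \<in> ?K \<longleftrightarrow> u \<in> ?K"
      proof
        assume "u \<otimes> k \<in> ?K"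
        then have "u \<otimes> k \<otimes> inv k \<in> ?K" using Kc k by blast
        then show "u \<in> ?K" using u KG[OF k] by (simp add: m_assoc)
      qed (use Kc k in blast)
      moreover have "\<pi> k (\<pi> (inv (u \<otimes> k)) v) = \<pi> (inv u) v" if "u \<in> ?K"
      proof -
        have "k \<otimes> inv (u \<otimes> k) = inv u" using u KG[OF k] by (simp add: group_normalize)
        then show ?thesis using mult[of k "inv (u \<otimes> k)" v] Kc k v that by simp
      qed
      ultimately show ?thesis using k by (auto simp: X_def)
    qed
    then show "X \<in> ?E"
      unfolding E using Kc KG v Vs(2) by (auto simp: X_def \<pi>V)
  qed
  have ne: "?E \<noteq> {0}"
  proof -
    obtain v where "v \<in> V" "v \<noteq> 0" using V0 Vs(2) by blast
    then show ?thesis using ex by fastforce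
  qed
  have "U = {0} \<or> U = ?E" if U: "subcomodule (Dvee G) (fscale s) ?E (E_coact G s) U" for U
  proof (cases "U = {0}")
    case False
    have csU: "complex_space (fscale s) U" and UE: "U \<subseteq> ?E"
      and ten: "\<And>X. X \<in> U \<Longrightarrow> E_coact G s X \<in> tensor_space (carrier G \<times> carrier G) U"
      using U by (auto simp: subcomodule_def hbasis_Dvee)
    note Us = complex_spaceD[OF csU]
    have coU: "E_coact G s X (u, v) \<in> U" if "X \<in> U" for X u v
      using ten[OF that] Us(2) by (cases "(u, v) \<in> carrier G \<times> carrier G") (auto simp: tensor_space_def)
    have shift: "\<exists>X'\<in>U. X' (\<one>, inv r) = X (g, inv r)" if X: "X \<in> U" and g: "g \<in> carrier G" for X g
    proof
      show "E_coact G s X (g, inv r) \<in> U" by (rule coU[OF X])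
      show "E_coact G s X (g, inv r) (\<one>, inv r) = X (g, inv r)" using g r by (simp add: co)
    qed
    let ?ev = "\<lambda>X :: 'a \<times> 'a \<Rightarrow> 'v. X (\<one>, inv r)"
    have lin_ev: "linear_map_on (fscale s) U s V ?ev"
      using UE unfolding linear_map_on_def by (auto simp: fscale_def E subset_iff)
    have "?ev ` U = {0} \<or> ?ev ` U = V"
    proof (rule irrU)
      show "complex_space s (?ev ` U)" by (rule complex_space_image[OF lin_ev csU V])
      show "?ev ` U \<subseteq> V" using lin_ev by (auto simp: linear_map_on_def)
      \<comment> \<open>By equivariance \<open>\<pi> k v\<close> is the value of \<open>X\<close> at
        \<open>inv k\<close>, and \<open>shift\<close> realises it as the value at the identity of
        another element of \<open>U\<close>.\<close>
      show "\<pi> k v \<in> ?ev ` U" if k: "k \<in> ?K" and v: "v \<in> ?ev ` U" for k v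
      proof -
        obtain X where X: "X \<in> U" "v = X (\<one>, inv r)" using v by blast
        then have "\<pi> k v = X (inv k, inv r)"
          using \<pi>E[of X "inv k"] UE k Kc KG by auto
        then show ?thesis using shift[OF X(1), of "inv k"] k KG by (metis image_eqI inv_closed)
      qed
    qed
    moreover have "?ev ` U \<noteq> {0}"
    proof
      assume 0: "?ev ` U = {0}"
      \<comment> \<open>By \<open>shift\<close>, every value of \<open>X\<close> on its possible
        support is the value at the identity of some element of \<open>U\<close>.\<close>
      have "X = 0" if X: "X \<in> U" for X
      proof
        fix b :: "'a \<times> 'a"
        obtain u z where b: "b = (u, z)" by (cases b)
        show "X b = 0 b"
        proof (cases "u \<in> carrier G \<and> z = inv r")
          case True
          then obtain X' where "X' \<in> U" "X' (\<one>, inv r) = X b" using shift[OF X, of u] b by blast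
          then have "X b \<in> ?ev ` U" by (metis image_eqI)
          then show ?thesis using 0 by simp
        qed (use zero[of X u z] X UE b in auto)
      qed
      then show False using False Us(2) by blast
    qed
    ultimately have ev: "?ev ` U = V" by blast
    have "Y \<in> U" if Y: "Y \<in> ?E" for Y
    proof -
      have "Y (g, inv r) \<in> ?ev ` U" for g
        using Y unfolding ev E by blast
      then obtain F where F: "F g \<in> U" "F g (\<one>, inv r) = Y (g, inv r)" for g
        using inv_into_into[of _ ?ev U] f_inv_into_f[of _ ?ev U]
          that[of "\<lambda>g. inv_into U ?ev (Y (g, inv r))"] by blast
      \<comment> \<open>The index moves \<open>F g\<close> from the identity to \<open>g\<close> and
        keeps only the coset of \<open>g\<close> modulo \<open>?K\<close>. There the result agrees
        with \<open>Y\<close>, since both are equivariant and have the same value at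
        \<open>g\<close>.\<close>
      define Z where "Z = (\<Sum>g\<in>carrier G. E_coact G s (F g) (inv g, g \<otimes> inv r \<otimes> inv g))"
      have ZU: "Z \<in> U" unfolding Z_def by (intro Us(5) coU F)
      have ZE: "Z \<in> ?E" using ZU UE by blast
      \<comment> \<open>The coset of \<open>w\<close> is produced by each of its
        \<open>card ?K\<close> elements \<open>g\<close>; dividing by this number recovers
        \<open>Y\<close>.\<close>
      have "Z b = s (of_nat (card ?K)) (Y b)" for b
      proof -
        obtain w z where b: "b = (w, z)" by (cases b)
        show ?thesis
        proof (cases "w \<in> carrier G \<and> z = inv r")
          case True
          then have w: "w \<in> carrier G" and z: "z = inv r" by auto
          have "E_coact G s (F g) (inv g, g \<otimes> inv r \<otimes> inv g) (w, inv r) =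
            (if inv g \<otimes> w \<in> ?K then Y (w, inv r) else 0)" if g: "g \<in> carrier G" for g
          proof -
            have "inv g \<otimes> w \<otimes> inv r \<otimes> inv (inv g \<otimes> w) = inv g \<otimes> (w \<otimes> inv r \<otimes> inv w) \<otimes> g"
              using w g r by (simp add: group_normalize)
            moreover have "g \<otimes> inv r \<otimes> inv g = w \<otimes> inv r \<otimes> inv w \<longleftrightarrow>
               inv r = inv g \<otimes> (w \<otimes> inv r \<otimes> inv w) \<otimes> g"
              using w g r by (simp add: conj_eq_iff)
            ultimately have iff: "g \<otimes> inv r \<otimes> inv g = w \<otimes> inv r \<otimes> inv w \<longleftrightarrow> inv g \<otimes> w \<in> ?K"
              using conj_eq_iff_centraliser(3)[OF r, of "inv g \<otimes> w"] w g by simp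
            have "F g (inv g \<otimes> w, inv r) = Y (w, inv r)" if k: "inv g \<otimes> w \<in> ?K"
            proof -
              have "F g (inv g \<otimes> w, inv r) = \<pi> (inv (inv g \<otimes> w)) (Y (g, inv r))"
                using \<pi>E[OF _ k, of "F g"] F[of g] UE by auto
              also have "Y (g, inv r) = \<pi> (inv g \<otimes> w) (Y (g \<otimes> (inv g \<otimes> w), inv r))"
                using Y k g unfolding E by simp
              also have "g \<otimes> (inv g \<otimes> w) = w" using g w by (simp add: inv_cancel_left)
              also have "\<pi> (inv (inv g \<otimes> w)) (\<pi> (inv g \<otimes> w) (Y (w, inv r))) = Y (w, inv r)"
                using mult[of "inv (inv g \<otimes> w)" "inv g \<otimes> w" "Y (w, inv r)"] k Kc KG[OF k] Y
                unfolding E by (simp add: one)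
              finally show ?thesis .
            qed
            then show ?thesis using g w r iff by (simp add: co)
          qed
          then have "Z b = (\<Sum>g\<in>carrier G. if inv g \<otimes> w \<in> ?K then Y (w, inv r) else 0)"
            by (simp add: Z_def sum_fun_apply b z)
          also have "\<dots> = (\<Sum>k\<in>carrier G. if k \<in> ?K then Y (w, inv r) else 0)"
            using w by (intro sum.reindex_bij_witness[where i = "\<lambda>k. w \<otimes> inv k" and j = "\<lambda>g. inv g \<otimes> w"])
              (auto simp: group_normalize)
          also have "\<dots> = (\<Sum>k\<in>?K. Y (w, inv r))"
            using centraliser_subset by (simp add: sum.If_cases Int_absorb1)
          also have "\<dots> = s (of_nat (card ?K)) (Y b)"
            by (simp add: V.sum_constant_scale b z)
          finally show ?thesis .
        qed (use zero[OF ZE] zero[OF Y] b in auto)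
      qed
      then have "Y = fscale s (1 / of_nat (card ?K)) Z"
        using fK Kc(1) by (auto simp: fun_eq_iff fscale_def)
      then show ?thesis using Us(4)[OF ZU] by simp
    qed
    then show ?thesis using UE by blast
  qed simp
  then show ?thesis
    unfolding coirreducible_def using left_comodule_E[OF r rep] ne by blast
qed

section \<open>Comparison with the module of a conjugacy class\<close>

text \<open>Any element of the class can serve as its base point: the conjugators for
  \<open>x\<close> and for \<open>r = a \<otimes> x \<otimes> inv a\<close> differ by right
  multiplication by \<open>a\<close>.\<close>

lemma conj_class_eq:
  assumes "C \<in> conj_classes G" "r \<in> C"
  shows "r \<in> carrier G" "C = (\<lambda>g. g \<otimes> r \<otimes> inv g) ` carrier G"
proof -
  obtain x where x: "x \<in> carrier G" and C: "C = (\<lambda>g. g \<otimes> x \<otimes> inv g) ` carrier G"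
    using assms(1) by (auto simp: conj_classes_def conj_class_def)
  obtain a where a: "a \<in> carrier G" and r: "r = a \<otimes> x \<otimes> inv a" using assms(2) C by blast
  show "r \<in> carrier G" using a x r by simp
  show "C = (\<lambda>g. g \<otimes> r \<otimes> inv g) ` carrier G"
  proof (intro equalityI subsetI)
    fix c assume "c \<in> C"
    then obtain g where g: "g \<in> carrier G" "c = g \<otimes> x \<otimes> inv g" using C by blast
    then have "c = (g \<otimes> inv a) \<otimes> r \<otimes> inv (g \<otimes> inv a)" using a x by (simp add: r group_normalize)
    then show "c \<in> (\<lambda>g. g \<otimes> r \<otimes> inv g) ` carrier G" using a g by blast
  next
    fix c assume "c \<in> (\<lambda>g. g \<otimes> r \<otimes> inv g) ` carrier G"
    then obtain g where g: "g \<in> carrier G" "c = g \<otimes> r \<otimes> inv g" by blast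
    then have "c = (g \<otimes> a) \<otimes> x \<otimes> inv (g \<otimes> a)" using a x by (simp add: r group_normalize)
    then show "c \<in> C" using a g C by blast
  qed
qed

text \<open>For fixed \<open>h\<close> and \<open>d\<close>, only
  \<open>c = inv h \<otimes> d \<otimes> h\<close> is carried to \<open>d\<close> by
  \<open>h\<close>, so the sum over the class in the group action has one term at \<open>d\<close>.
  The delta function then keeps it only for \<open>g = d\<close>.\<close>

lemma class_act_eq:
  assumes C: "C = (\<lambda>g. g \<otimes> r \<otimes> inv g) ` carrier G" and r: "r \<in> carrier G" and s: "vector_space s"
  shows "class_act G C q s \<pi> \<phi> X d = (if d \<in> C then
    \<Sum>(g, h)\<in>carrier G \<times> carrier G. s (\<phi> (g, h))
      (if g = d then \<pi> (zeta G q (inv h \<otimes> d \<otimes> h) h) (X (inv h \<otimes> d \<otimes> h)) else 0) else 0)"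
proof -
  interpret V: vector_space s by (rule s)
  have fC: "finite C" using C by simp
  have CG: "C \<subseteq> carrier G" using C r by auto
  have conj: "inv h \<otimes> d \<otimes> h \<in> C" if "d \<in> C" "h \<in> carrier G" for d h
  proof -
    obtain g where "g \<in> carrier G" "d = g \<otimes> r \<otimes> inv g" using \<open>d \<in> C\<close> C by blast
    then have "inv h \<otimes> d \<otimes> h = (inv h \<otimes> g) \<otimes> r \<otimes> inv (inv h \<otimes> g)"
      using that r by (simp add: group_normalize)
    then show ?thesis using that C \<open>g \<in> carrier G\<close> by blast
  qed
  have grp: "class_group_act G C q \<pi> h X d = \<pi> (zeta G q (inv h \<otimes> d \<otimes> h) h) (X (inv h \<otimes> d \<otimes> h))"
    if d: "d \<in> C" and h: "h \<in> carrier G" for d h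
  proof -
    have "class_group_act G C q \<pi> h X d =
      (\<Sum>c\<in>C. if c = inv h \<otimes> d \<otimes> h then \<pi> (zeta G q c h) (X c) else 0)"
      unfolding class_group_act_def sum_fun_apply
    proof (intro sum.cong refl)
      fix c assume "c \<in> C"
      then have "h \<otimes> c \<otimes> inv h = d \<longleftrightarrow> c = inv h \<otimes> d \<otimes> h" using d h CG by (intro conj_eq_iff) auto
      then show "tens (h \<otimes> c \<otimes> inv h) (\<pi> (zeta G q c h) (X c)) d =
        (if c = inv h \<otimes> d \<otimes> h then \<pi> (zeta G q c h) (X c) else 0)"
        by (auto simp: tens_def)
    qed
    then show ?thesis using conj[OF d h] fC by (simp add: sum.delta)
  qed
  have del: "class_delta_act C g Y d = (if d \<in> C then if g = d then Y d else 0 else 0)" for g d and Y :: "'a \<Rightarrow> 'c"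
  proof -
    have "class_delta_act C g Y d = (\<Sum>c\<in>C. if c = d then if g = d then Y d else 0 else 0)"
      unfolding class_delta_act_def sum_fun_apply by (intro sum.cong) (auto simp: tens_def)
    then show ?thesis using fC by (simp add: sum.delta)
  qed
  show ?thesis
  proof (cases "d \<in> C")
    case True
    show ?thesis
      unfolding class_act_def hbasis_DG sum_fun_apply
      using True by (auto simp: fscale_def del grp intro!: sum.cong)
  next
    case False
    then show ?thesis
      unfolding class_act_def hbasis_DG sum_fun_apply by (auto simp: fscale_def del split_def)
  qed
qed

text \<open>An element of \<open>E\<close> is determined by one value on each coset of the
  centraliser, and the \<open>q c\<close> represent these cosets. The cocycle \<open>zeta\<close>
  appears because \<open>inv h \<otimes> q d\<close> and
  \<open>q (inv h \<otimes> d \<otimes> h)\<close> lie in the same coset and differ by exactly this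
  element. That \<open>class_act\<close> is an action then follows by transport from
  \<open>E\<close>.\<close>

lemma module_isomorphic_E:
  assumes C: "C \<in> conj_classes G" "r \<in> C"
    and rep: "representation_on G (centraliser G r) s V \<pi>" and q: "class_section G C r q"
  shows "module_isomorphic (DG G)
     (fscale s) (E_space G r s V \<pi>) (DG_action_of_coact G (fscale s) (E_coact G s))
     (fscale s) (tensor_space C V) (class_act G C q s \<pi>)"
proof -
  let ?K = "centraliser G r" and ?E = "E_space G r s V \<pi>" and ?T = "tensor_space C V"
  note r = conj_class_eq(1)[OF C] and C_eq = conj_class_eq(2)[OF C]
  have V: "complex_space s V" and lin: "k \<in> ?K \<Longrightarrow> linear_map_on s V s V (\<pi> k)"
    and one: "v \<in> V \<Longrightarrow> \<pi> \<one> v = v"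
    and mult: "k \<in> ?K \<Longrightarrow> l \<in> ?K \<Longrightarrow> v \<in> V \<Longrightarrow> \<pi> (k \<otimes> l) v = \<pi> k (\<pi> l v)" for k l v
    using rep by (auto simp: representation_on_def)
  note Vs = complex_spaceD[OF V]
  note E = E_space_iff[OF r rep] and co = E_coact_eq[OF Vs(1)]
  have KG: "k \<in> ?K \<Longrightarrow> k \<in> carrier G" for k by (simp add: centraliser_def)
  have \<pi>V: "\<pi> k v \<in> V" if "k \<in> ?K" "v \<in> V" for k v using linear_map_onD(1)[OF lin] that by blast
  have CG: "C \<subseteq> carrier G" using C_eq r by auto
  have qG: "q c \<in> carrier G" and qc: "q c \<otimes> r \<otimes> inv (q c) = c" if "c \<in> C" for c
    using q that by (auto simp: class_section_def)
  have XV: "X b \<in> V" if "X \<in> ?E" for X b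
    using that unfolding E by blast
  have XE: "\<pi> k (X (u \<otimes> k, inv r)) = X (u, inv r)" if "X \<in> ?E" "u \<in> carrier G" "k \<in> ?K" for X u k
    using that unfolding E by blast
  have conjC: "u \<otimes> r \<otimes> inv u \<in> C" if "u \<in> carrier G" for u using C_eq that by blast
  have inK: "inv u \<otimes> v \<in> ?K" if "u \<in> carrier G" "v \<in> carrier G" "u \<otimes> r \<otimes> inv u = v \<otimes> r \<otimes> inv v" for u v
  proof -
    have "inv u \<otimes> (u \<otimes> r \<otimes> inv u) \<otimes> u = r" using that(1) r by (simp add: group_normalize)
    moreover have "(inv u \<otimes> v) \<otimes> r \<otimes> inv (inv u \<otimes> v) = inv u \<otimes> (v \<otimes> r \<otimes> inv v) \<otimes> u"
      using that(1,2) r by (simp add: group_normalize)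
    ultimately have "(inv u \<otimes> v) \<otimes> r \<otimes> inv (inv u \<otimes> v) = r" using that(3) by simp
    then show ?thesis using conj_eq_iff_centraliser(1)[OF r, of "inv u \<otimes> v"] that by simp
  qed
  define f where "f = (\<lambda>(X :: 'a \<times> 'a \<Rightarrow> 'c) c. if c \<in> C then X (q c, inv r) else 0)"
  \<comment> \<open>The value at \<open>u\<close> is recovered from the representative
    \<open>q c\<close> of its coset, with \<open>c = u \<otimes> r \<otimes> inv u\<close>:
    equivariance is applied to \<open>inv u \<otimes> q c\<close>, which lies in the
    centraliser.\<close>
  define f' where "f' = (\<lambda>Y (u, z). if u \<in> carrier G \<and> z = inv r
    then \<pi> (inv u \<otimes> q (u \<otimes> r \<otimes> inv u)) (Y (u \<otimes> r \<otimes> inv u)) else 0)"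
  have qK: "inv u \<otimes> q (u \<otimes> r \<otimes> inv u) \<in> ?K" if "u \<in> carrier G" for u
    using that qG[OF conjC] qc[OF conjC] by (intro inK) simp_all
  have lin_f: "linear_map_on (fscale s) ?E (fscale s) ?T f"
    using XV by (auto simp: linear_map_on_def f_def tensor_space_def fscale_def fun_eq_iff Vs)
  have "bij_betw f ?E ?T"
  proof (rule bij_betw_byWitness[where f' = f'])
    show "\<forall>X\<in>?E. f' (f X) = X"
    proof
      fix X assume X: "X \<in> ?E"
      have "f' (f X) (u, z) = X (u, z)" for u z
      proof (cases "u \<in> carrier G \<and> z = inv r")
        case True
        then have u: "u \<in> carrier G" and z: "z = inv r" by auto
        have "u \<otimes> (inv u \<otimes> q (u \<otimes> r \<otimes> inv u)) = q (u \<otimes> r \<otimes> inv u)"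
          using u qG[OF conjC[OF u]] by (simp add: inv_cancel_left)
        then show ?thesis using XE[OF X u qK[OF u]] u z conjC[OF u] by (simp add: f'_def f_def)
      next
        case False
        then have "X (u, z) = 0" using X unfolding E by blast
        then show ?thesis using False by (auto simp: f'_def)
      qed
      then show "f' (f X) = X" by auto
    qed
    show "\<forall>Y\<in>?T. f (f' Y) = Y"
    proof
      fix Y assume Y: "Y \<in> ?T"
      have "f (f' Y) c = Y c" for c
      proof (cases "c \<in> C")
        case True
        then show ?thesis using Y qG[OF True] qc[OF True]
          by (simp add: f_def f'_def tensor_space_def one)
      qed (use Y in \<open>simp add: f_def tensor_space_def\<close>)
      then show "f (f' Y) = Y" by auto
    qed
    show "f ` ?E \<subseteq> ?T" using lin_f by (auto simp: linear_map_on_def)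
    show "f' ` ?T \<subseteq> ?E"
    proof clarify
      fix Y assume "Y \<in> ?T"
      then have YV: "Y c \<in> V" if "c \<in> C" for c using that by (simp add: tensor_space_def)
      have "\<pi> k (f' Y (u \<otimes> k, inv r)) = f' Y (u, inv r)" if u: "u \<in> carrier G" and k: "k \<in> ?K" for u k
      proof -
        let ?c = "u \<otimes> r \<otimes> inv u"
        note kG = KG[OF k]
        have "k \<otimes> r \<otimes> inv k = r" using conj_eq_iff_centraliser(1)[OF r kG] k by simp
        moreover have "u \<otimes> k \<otimes> r \<otimes> inv (u \<otimes> k) = u \<otimes> (k \<otimes> r \<otimes> inv k) \<otimes> inv u"
          using u kG r by (simp add: group_normalize)
        ultimately have c: "u \<otimes> k \<otimes> r \<otimes> inv (u \<otimes> k) = ?c" by simp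
        have "k \<otimes> (inv (u \<otimes> k) \<otimes> q ?c) = inv u \<otimes> q ?c"
          using u kG qG[OF conjC[OF u]] by (simp add: group_normalize)
        then have "\<pi> k (\<pi> (inv (u \<otimes> k) \<otimes> q ?c) (Y ?c)) = \<pi> (inv u \<otimes> q ?c) (Y ?c)"
          using mult[OF k, of "inv (u \<otimes> k) \<otimes> q ?c" "Y ?c"] qK[of "u \<otimes> k"] u kG YV[OF conjC[OF u]]
          by (simp add: c)
        then show ?thesis using u kG by (simp add: f'_def c)
      qed
      moreover have "f' Y b \<in> V" for b
        using YV[OF conjC] qK \<pi>V Vs(2) by (cases b) (auto simp: f'_def)
      ultimately show "f' Y \<in> ?E" unfolding E by (auto simp: f'_def)
    qed
  qed
  moreover have "f (DG_action_of_coact G (fscale s) (E_coact G s) \<phi> X) = class_act G C q s \<pi> \<phi> (f X)"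
    if X: "X \<in> ?E" for \<phi> X
  proof
    fix d
    show "f (DG_action_of_coact G (fscale s) (E_coact G s) \<phi> X) d = class_act G C q s \<pi> \<phi> (f X) d"
    proof (cases "d \<in> C")
      case d: True
      then have dG: "d \<in> carrier G" using CG by blast
      have "E_coact G s X (inv h, inv g) (q d, inv r) =
        (if g = d then \<pi> (zeta G q (inv h \<otimes> d \<otimes> h) h) (f X (inv h \<otimes> d \<otimes> h)) else 0)"
        if g: "g \<in> carrier G" and h: "h \<in> carrier G" for g h
      proof -
        let ?c = "inv h \<otimes> d \<otimes> h"
        have "inv h \<otimes> (q d \<otimes> r \<otimes> inv (q d)) \<otimes> h = (inv h \<otimes> q d) \<otimes> r \<otimes> inv (inv h \<otimes> q d)"
          using h qG[OF d] r by (simp add: group_normalize)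
        then have c_eq: "?c = (inv h \<otimes> q d) \<otimes> r \<otimes> inv (inv h \<otimes> q d)" using qc[OF d] by simp
        then have c: "?c \<in> C" using conjC[of "inv h \<otimes> q d"] h qG[OF d] by simp
        have "h \<otimes> ?c \<otimes> inv h = d" using h dG by (simp add: group_normalize)
        then have "zeta G q ?c h = inv (q d) \<otimes> h \<otimes> q ?c" by (simp add: zeta_def)
        also have "\<dots> = inv (inv h \<otimes> q d) \<otimes> q ?c"
          using h qG[OF d] by (simp add: inv_mult_group)
        finally have z: "zeta G q ?c h = inv (inv h \<otimes> q d) \<otimes> q ?c" .
        have zK: "zeta G q ?c h \<in> ?K"
          unfolding z using h qG[OF d] qG[OF c] qc[OF c] c_eq by (intro inK) auto
        have "(inv h \<otimes> q d) \<otimes> zeta G q ?c h = q ?c"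
          unfolding z using h qG[OF d] qG[OF c] by (simp add: inv_cancel_left)
        then have *: "X (inv h \<otimes> q d, inv r) = \<pi> (zeta G q ?c h) (X (q ?c, inv r))"
          using XE[OF X _ zK, of "inv h \<otimes> q d"] h qG[OF d] by simp
        \<comment> \<open>The inverse in the degree \<open>inv g\<close> cancels against the one in
          \<open>inv r\<close>, so the projection to degree \<open>inv g\<close> becomes the
          projection to the class element \<open>g\<close>.\<close>
        have "q d \<otimes> inv r \<otimes> inv (q d) = inv (q d \<otimes> r \<otimes> inv (q d))"
          using qG[OF d] r by (simp add: group_normalize)
        then have "q d \<otimes> inv r \<otimes> inv (q d) = inv d" using qc[OF d] by simp
        moreover have "inv g = inv d \<longleftrightarrow> g = d" using g dG by (metis inv_inv)
        ultimately show ?thesis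
          using h r qG[OF d] c by (simp add: co * f_def)
      qed
      moreover have "f Z d = Z (q d, inv r)" for Z using d by (simp add: f_def)
      ultimately show ?thesis
        unfolding class_act_eq[OF C_eq r Vs(1)] DG_action_of_coact_eq[OF vector_space_fscale[OF Vs(1)]]
        using d by (auto simp: sum_fun_apply split_def fscale_def intro!: sum.cong)
    qed (simp add: class_act_eq[OF C_eq r Vs(1)] f_def)
  qed
  ultimately show ?thesis
    using left_module_of_left_comodule[OF left_comodule_E[OF r rep]]
      complex_space_tensor_space[OF V] lin_f hunit_DG hprod_DG
    by (intro module_isomorphicI)
qed

section \<open>Classification of the coirreducible comodules\<close>

text \<open>
  The map \<open>x \<mapsto> \<rho> x (\<one>, h)\<close> is the projection to degree \<open>h\<close>, on which \<open>\<delta>\<^sub>g \<otimes> \<one>\<close> with \<open>g = inv h\<close> acts as the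
  identity. The map to \<open>E\<close> is the one given by Frobenius reciprocity, and it is onto because \<open>E\<close> is
  coirreducible.
\<close>

lemma coirreducible_Dvee_isomorphic_E:
  assumes irr: "coirreducible (Dvee G) s M \<rho>"
  shows "\<exists>C\<in>conj_classes G. \<forall>r\<in>C. \<exists>V \<pi>.
     irreducible_rep G (centraliser G r) s V \<pi> \<and>
     comodule_isomorphic (Dvee G) s M \<rho> (fscale s) (E_space G r s V \<pi>) (E_coact G s)"
proof -
  have lc: "left_comodule (Dvee G) s M \<rho>" and M0: "M \<noteq> {0}"
    and irrU: "\<And>U. subcomodule (Dvee G) s M \<rho> U \<Longrightarrow> U = {0} \<or> U = M"
    using irr by (auto simp: coirreducible_def)
  have M: "complex_space s M"
    and lin: "linear_map_on s M (fscale s) (tensor_space (carrier G \<times> carrier G) M) \<rho>"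
    and co: "\<And>x u v w z. x \<in> M \<Longrightarrow> u \<in> carrier G \<Longrightarrow> v \<in> carrier G \<Longrightarrow> w \<in> carrier G \<Longrightarrow> z \<in> carrier G \<Longrightarrow>
       \<rho> (\<rho> x (u, v)) (w, z) = (if v = w \<otimes> z \<otimes> inv w then \<rho> x (u \<otimes> w, z) else 0)"
    and cou: "\<And>x. x \<in> M \<Longrightarrow> (\<Sum>h\<in>carrier G. \<rho> x (\<one>, h)) = x"
    using lc by (auto simp: left_comodule_Dvee_iff)
  note Ms = complex_spaceD[OF M]
  interpret V: vector_space s by (rule Ms(1))
  have rM: "\<rho> x b \<in> M" and r0: "b \<notin> carrier G \<times> carrier G \<Longrightarrow> \<rho> x b = 0" if "x \<in> M" for x b
    using linear_map_onD(1)[OF lin that] Ms(2)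
    by (cases b; cases "b \<in> carrier G \<times> carrier G"; auto simp: tensor_space_def)+
  have radd: "\<rho> (x + y) b = \<rho> x b + \<rho> y b" if "x \<in> M" "y \<in> M" for x y b
    using linear_map_onD(2)[OF lin] that by auto
  have rsc: "\<rho> (s a x) b = s a (\<rho> x b)" if "x \<in> M" for x a b
    using linear_map_onD(3)[OF lin] that by (auto simp: fscale_def)
  have rz: "\<rho> 0 b = 0" for b using linear_map_on_zero[OF lin M] by simp
  obtain x0 where x0: "x0 \<in> M" "x0 \<noteq> 0" using M0 Ms(2) by blast
  \<comment> \<open>The projections to the degrees sum to the identity, so \<open>x0\<close> has a
    nonzero component in some degree \<open>v\<close>. The class sought is that of
    \<open>inv v\<close>, because the representation for \<open>r\<close> is found in degree
    \<open>inv r\<close>.\<close>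
  obtain v where v: "v \<in> carrier G" "\<rho> x0 (\<one>, v) \<noteq> 0"
    using cou[OF x0(1)] x0(2) by (metis sum.neutral)
  have "\<exists>V \<pi>. irreducible_rep G (centraliser G r) s V \<pi> \<and>
     comodule_isomorphic (Dvee G) s M \<rho> (fscale s) (E_space G r s V \<pi>) (E_coact G s)"
    if rC: "r \<in> conj_class G (inv v)" for r
  proof -
    obtain a where a: "a \<in> carrier G" and r_eq: "r = a \<otimes> inv v \<otimes> inv a"
      using rC by (auto simp: conj_class_def)
    have r: "r \<in> carrier G" and ir: "inv r = a \<otimes> v \<otimes> inv a" using a v r_eq by (auto simp: group_normalize)
    let ?K = "centraliser G r"
    have KG: "k \<in> ?K \<Longrightarrow> k \<in> carrier G" for k by (simp add: centraliser_def)
    note Kc = centraliser_closed[OF r]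
    \<comment> \<open>\<open>V\<close> is the homogeneous component of degree \<open>inv r\<close>.
      Translation is a right action, hence the \<open>inv k\<close> in \<open>\<pi>\<close>; for
      \<open>k\<close> in the centraliser it preserves this degree.\<close>
    define V where "V = (\<lambda>x. \<rho> x (\<one>, inv r)) ` M"
    define \<pi> where "\<pi> k x = \<rho> x (inv k, inv r)" for k x
    have V_iff: "x \<in> V \<longleftrightarrow> x \<in> M \<and> \<rho> x (\<one>, inv r) = x" for x
    proof
      assume "x \<in> M \<and> \<rho> x (\<one>, inv r) = x"
      then show "x \<in> V" unfolding V_def by (metis imageI)
    qed (use r in \<open>auto simp: V_def co rM\<close>)
    have rV: "\<rho> x (g, inv r) \<in> V" if "x \<in> M" "g \<in> carrier G" for x g
      using that r by (simp add: V_iff co rM)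
    have VM: "x \<in> M" if "x \<in> V" for x using that V_iff by blast
    have csV: "complex_space s V"
      by (auto simp: complex_space_iff[OF Ms(1)] V_iff Ms(2-4) rz radd rsc)
    have \<pi>V: "\<pi> k x \<in> V" if "k \<in> ?K" "x \<in> V" for k x
      using rV[of x "inv k"] that VM KG by (simp add: \<pi>_def)
    have conjK: "inv k \<otimes> inv r \<otimes> k = inv r" if "k \<in> ?K" for k
      using conj_eq_iff_centraliser(2)[OF r, of "inv k"] Kc(3)[OF that] KG[OF that] by simp
    \<comment> \<open>Translation by \<open>g\<close> moves degree \<open>inv r\<close> to
      \<open>inv g \<otimes> inv r \<otimes> g\<close>, so the projection back to degree
      \<open>inv r\<close> is zero unless \<open>g\<close> centralises \<open>r\<close>.\<close>
    have coV: "\<rho> x (g, inv r) = (if g \<in> ?K then \<pi> (inv g) x else 0)" if "x \<in> V" "g \<in> carrier G" for x g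
    proof -
      have "\<rho> x (g, inv r) = \<rho> (\<rho> x (\<one>, inv r)) (g, inv r)" using that V_iff by simp
      also have "\<dots> = (if g \<in> ?K then \<rho> x (g, inv r) else 0)"
        using that VM r conj_eq_iff_centraliser(3)[OF r that(2)] by (simp add: co)
      finally show ?thesis using that by (auto simp: \<pi>_def split: if_splits)
    qed
    have \<pi>\<rho>: "\<pi> k (\<rho> x (u \<otimes> k, inv r)) = \<rho> x (u, inv r)" if "x \<in> M" "u \<in> carrier G" "k \<in> ?K" for x u k
      using that KG r conjK by (simp add: \<pi>_def co m_assoc)
    have rep: "representation_on G ?K s V \<pi>"
      unfolding representation_on_def
    proof (intro conjI ballI)
      show "linear_map_on s V s V (\<pi> k)" if "k \<in> ?K" for k
        using that by (auto simp: linear_map_on_def \<pi>V) (auto simp: \<pi>_def radd rsc VM)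
      show "\<pi> \<one> x = x" if "x \<in> V" for x using that by (simp add: \<pi>_def V_iff)
      show "\<pi> (k \<otimes> l) x = \<pi> k (\<pi> l x)" if "k \<in> ?K" "l \<in> ?K" "x \<in> V" for k l x
        using that VM r KG conjK by (simp add: \<pi>_def co inv_mult_group)
    qed (rule csV)
    have V0: "V \<noteq> {0}"
    proof
      assume "V = {0}"
      then have "\<rho> x0 (inv a, inv r) = 0" using rV[OF x0(1), of "inv a"] a by simp
      \<comment> \<open>Translation by \<open>inv a\<close> carries degree \<open>v\<close> to
        degree \<open>inv r\<close>, and translation by \<open>a\<close> undoes it.\<close>
      moreover have "\<rho> (\<rho> x0 (inv a, inv r)) (a, v) = \<rho> x0 (\<one>, v)"
        using x0 a v r ir by (simp add: co)
      ultimately show False using v rz by simp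
    qed
    \<comment> \<open>For every subspace \<open>U\<close> this set is a subcomodule, because the
      degree \<open>inv r\<close> components of a component of \<open>x\<close> are zero or again of
      the form \<open>\<rho> x (g, inv r)\<close>. A stable \<open>U\<close> inside \<open>V\<close>
      will give irreducibility of \<open>V\<close>, and \<open>U = {0}\<close> injectivity of the
      map to \<open>E\<close>.\<close>
    have ker: "{x \<in> M. \<forall>g\<in>carrier G. \<rho> x (g, inv r) \<in> U} = {0} \<or>
        {x \<in> M. \<forall>g\<in>carrier G. \<rho> x (g, inv r) \<in> U} = M" if U: "complex_space s U" for U
    proof (rule irrU)
      let ?N = "{x \<in> M. \<forall>g\<in>carrier G. \<rho> x (g, inv r) \<in> U}"
      note Us = complex_spaceD[OF U]
      have "complex_space s ?N"
        by (auto simp: complex_space_iff[OF Ms(1)] Us(2-4) Ms(2-4) rz radd rsc)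
      moreover have "\<rho> x b \<in> ?N" if "x \<in> ?N" "b \<in> carrier G \<times> carrier G" for x b
        using that r by (auto simp: co rM Us(2))
      ultimately show "subcomodule (Dvee G) s M \<rho> ?N"
        by (auto simp: subcomodule_def tensor_space_def hbasis_Dvee r0)
    qed
    have irrV: "irreducible_rep G ?K s V \<pi>"
      unfolding irreducible_rep_def
    proof (intro conjI allI impI rep V0)
      fix U assume U: "complex_space s U \<and> U \<subseteq> V \<and> (\<forall>k\<in>?K. \<forall>u\<in>U. \<pi> k u \<in> U)"
      let ?N = "{x \<in> M. \<forall>g\<in>carrier G. \<rho> x (g, inv r) \<in> U}"
      have U0: "0 \<in> U" using U complex_spaceD(2) by blast
      have "?N = {0} \<or> ?N = M" using ker U by blast
      moreover have "U \<subseteq> ?N"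
      proof
        fix u assume u: "u \<in> U"
        then have uV: "u \<in> V" using U by blast
        have "\<rho> u (g, inv r) \<in> U" if g: "g \<in> carrier G" for g
          using coV[OF uV g] U u U0 Kc(3) by auto
        then show "u \<in> ?N" using VM[OF uV] by simp
      qed
      moreover have "V \<subseteq> U" if N: "?N = M"
      proof
        fix x assume x: "x \<in> V"
        then have "x \<in> ?N" using VM N by blast
        then have "\<rho> x (\<one>, inv r) \<in> U" by simp
        then show "x \<in> U" using x V_iff by simp
      qed
      ultimately show "U = {0} \<or> U = V" using U U0 by blast
    qed
    let ?E = "E_space G r s V \<pi>"
    note E = E_space_iff[OF r rep] and Eco = E_coact_eq[OF Ms(1)]
    \<comment> \<open>Only the second coordinate is tested: for \<open>x\<close> in \<open>M\<close>
      and \<open>w\<close> outside the carrier, \<open>\<rho> x (w, inv r)\<close> is zero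
      already.\<close>
    define f where "f x = (\<lambda>(w, z). if z = inv r then \<rho> x (w, inv r) else 0)" for x
    have fE: "f x \<in> ?E" if x: "x \<in> M" for x
    proof -
      have "\<rho> x (w, inv r) \<in> V" for w
        using rV[OF x, of w] r0[OF x, of "(w, inv r)"] complex_spaceD(2)[OF csV] by (cases "w \<in> carrier G") auto
      then show ?thesis
        unfolding E using complex_spaceD(2)[OF csV] r0[OF x] \<pi>\<rho>[OF x] by (auto simp: f_def)
    qed
    have lin_f: "linear_map_on s M (fscale s) ?E f"
      unfolding linear_map_on_def using fE
      by (auto simp: f_def fun_eq_iff radd rsc fscale_def)
    have comm: "E_coact G s (f x) b = f (\<rho> x b)" if x: "x \<in> M" and b: "b \<in> carrier G \<times> carrier G" for x b
    proof
      fix c :: "'a \<times> 'a"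
      obtain u v' w z where bc: "b = (u, v')" "c = (w, z)" by (metis surj_pair)
      show "E_coact G s (f x) b c = f (\<rho> x b) c"
        using x b r r0[OF rM[OF x]] by (cases "w \<in> carrier G") (auto simp: bc Eco f_def co)
    qed
    have inj: "inj_on f M"
    proof (rule inj_onI)
      fix x y assume x: "x \<in> M" and y: "y \<in> M" and eq: "f x = f y"
      have cs0: "complex_space s {0}" by (simp add: complex_space_iff[OF Ms(1)])
      let ?N = "{x \<in> M. \<forall>g\<in>carrier G. \<rho> x (g, inv r) \<in> {0}}"
      have "?N \<noteq> M"
      proof
        assume N: "?N = M"
        have "x = 0" if x: "x \<in> V" for x
        proof -
          have "x \<in> ?N" using N VM[OF x] by blast
          then have "\<rho> x (\<one>, inv r) = 0" by simp
          then show ?thesis using x V_iff by simp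
        qed
        then show False using V0 complex_spaceD(2)[OF csV] by blast
      qed
      then have N: "?N = {0}" using ker[OF cs0] by blast
      have eq': "\<rho> x (g, inv r) = \<rho> y (g, inv r)" for g
        using fun_cong[OF eq, of "(g, inv r)"] by (simp add: f_def)
      \<comment> \<open>The difference is written with \<open>s (- 1)\<close> because linearity and
        closure are available for addition and scalar multiplication.\<close>
      have "\<rho> (x + s (- 1) y) (g, inv r) = \<rho> x (g, inv r) + s (- 1) (\<rho> y (g, inv r))" for g
        by (simp only: radd[OF x Ms(4)[OF y]] rsc[OF y])
      then have "\<rho> (x + s (- 1) y) (g, inv r) = 0" for g
        by (simp add: eq' V.scale_minus_left)
      then have "x + s (- 1) y \<in> ?N"
        using Ms(3)[OF x Ms(4)[OF y]] by blast
      then have "x + s (- 1) y = 0" unfolding N by simp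
      then show "x = y" by (simp add: V.scale_minus_left)
    qed
    have coirr: "coirreducible (Dvee G) (fscale s) ?E (E_coact G s)" by (rule coirreducible_E[OF r irrV])
    then have lcE: "left_comodule (Dvee G) (fscale s) ?E (E_coact G s)" by (simp add: coirreducible_def)
    then have csE: "complex_space (fscale s) ?E" by (simp add: left_comodule_def)
    have "subcomodule (Dvee G) (fscale s) ?E (E_coact G s) (f ` M)"
      unfolding subcomodule_def
    proof (intro conjI ballI)
      show "complex_space (fscale s) (f ` M)" by (rule complex_space_image[OF lin_f M csE])
      show "f ` M \<subseteq> ?E" using fE by blast
      fix X assume "X \<in> f ` M"
      then obtain x where x: "x \<in> M" "X = f x" by blast
      have "E_coact G s X \<in> tensor_space (hbasis (Dvee G)) ?E"
        using lcE fE[OF x(1)] x(2) by (auto simp: left_comodule_def linear_map_on_def)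
      then show "E_coact G s X \<in> tensor_space (hbasis (Dvee G)) (f ` M)"
        using comm[OF x(1)] rM[OF x(1)] x(2) by (auto simp: tensor_space_def hbasis_Dvee)
    qed
    then have "f ` M = {0} \<or> f ` M = ?E" using coirr by (simp add: coirreducible_def)
    moreover have "f ` M \<noteq> {0}"
    proof
      assume "f ` M = {0}"
      then have "f x0 = 0" "f 0 = 0" using imageI[of _ M f] x0(1) Ms(2) by auto
      then show False using inj_onD[OF inj, of x0 0] x0 Ms(2) by simp
    qed
    ultimately have "bij_betw f M ?E" using inj by (simp add: bij_betw_def)
    then have "comodule_isomorphic (Dvee G) s M \<rho> (fscale s) ?E (E_coact G s)"
      unfolding comodule_isomorphic_def hbasis_Dvee using lc lcE lin_f comm by blast
    with irrV show ?thesis by blast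
  qed
  moreover have "conj_class G (inv v) \<in> conj_classes G"
    using v by (simp add: conj_classes_def)
  ultimately show ?thesis by blast
qed

end

text \<open>In the classification the representation space is found inside the comodule itself, so
  the type and the scalar multiplication of \<open>M\<close> serve for \<open>V\<close> too. This is
  what allows the existence claim without a quantifier over types.\<close>

theorem lemma3p3:
  fixes G :: "('g, 'z) monoid_scheme"
  assumes "group G" and "finite (carrier G)"
  shows
    "(\<forall>C r (s :: complex \<Rightarrow> 'v::ab_group_add \<Rightarrow> 'v) V \<pi>.
        C \<in> conj_classes G \<longrightarrow> r \<in> C \<longrightarrow> irreducible_rep G (centraliser G r) s V \<pi> \<longrightarrow>
          coirreducible (Dvee G) (fscale s) (E_space G r s V \<pi>) (E_coact G s) \<and>
          (\<forall>q. class_section G C r q \<longrightarrow>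
             module_isomorphic (DG G)
               (fscale s) (E_space G r s V \<pi>) (DG_action_of_coact G (fscale s) (E_coact G s))
               (fscale s) (tensor_space C V) (class_act G C q s \<pi>))) \<and>
     (\<forall>(s :: complex \<Rightarrow> 'm::ab_group_add \<Rightarrow> 'm) M \<rho>.
        coirreducible (Dvee G) s M \<rho> \<longrightarrow>
          (\<exists>C\<in>conj_classes G. \<forall>r\<in>C. \<exists>V \<pi>.
             irreducible_rep G (centraliser G r) s V \<pi> \<and>
             comodule_isomorphic (Dvee G) s M \<rho> (fscale s) (E_space G r s V \<pi>) (E_coact G s)))"
proof -
  interpret finite_group G
    using assms by (simp add: finite_group_def finite_group_axioms_def)
  show ?thesis
    by (intro conjI allI impI coirreducible_E module_isomorphic_E coirreducible_Dvee_isomorphic_E)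
      (auto simp: irreducible_rep_def intro: conj_class_eq(1))
qed

end
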